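(* Let $\alpha\in(0,1]$, $F\in C^{1,\alpha}_{\mathsf h}(\mathbb H,\mathbb R^2)$ and $p\in\mathbb H$ nondegenerate for $F$. Then there exists $\delta_4>0$ such that for every $\delta\in(0,\delta_4]$ there is $\varepsilon_4=\varepsilon_4(\delta)>0$ such that for every $q\in B(p,\varepsilon_4)$ there is an injective solution $\gamma$ to the LSDE associated to $F$ and $p$ on $I=[-\delta,\delta]$ with $\gamma_0=q$ and $$\gamma(I)\cap B(p,\varepsilon_4)=F^{-1}(F(q))\cap B(p,\varepsilon_4).$$
   Context: The Heisenberg group $\mathbb H$ is $\mathbb R^3$ with product $(x^1,x^2,x^3)(y^1,y^2,y^3)=(x^1+y^1,x^2+y^2,x^3+y^3+x^1y^2-x^2y^1)$, inverse $x^{-1}=-x$. For $x\in\mathbb H$: $x^{\mathsf h}=(x^1,x^2)$, $x^{\mathsf v}=x^3$. $\mathsf d$ is a fixed distance on $\mathbb H$, left-invariant and $1$-homogeneous w.r.t. dilations $\delta_r(x)=(rx^1,rx^2,r^2x^3)$; $B(x,r)$ is the open $\mathsf d$-ball. $X_1=\partial_1-x^2\partial_3$, $X_2=\partial_2+x^1\partial_3$. $C^{1,\alpha}_{\mathsf h}(\mathbb H,\mathbb R^2)$: maps $F$ with $X_1F,X_2F$ existing everywhere and $\nabla_{\mathsf h}F=[X_1F,X_2F]$ $\alpha$-Hölder w.r.t. $\mathsf d$ on bounded sets. $p$ nondegenerate: $\nabla_{\mathsf h}F(p)$ invertible. $\mathrm R(x,y):=F(y)-F(x)-\nabla_{\mathsf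 h}F(x)(x^{-1}y)^{\mathsf h}$. LSDE associated to $F$, $p$: a continuous $\gamma:I\to\mathbb H$ ($I$ an interval) with, for all $s,t\in I$, $(\gamma_s^{-1}\gamma_t)^{\mathsf h}=-\nabla_{\mathsf h}F(p)^{-1}(\mathrm R(p,\gamma_t)-\mathrm R(p,\gamma_s))$ and $(\gamma_s^{-1}\gamma_t)^{\mathsf v}=t-s+\mathbb E_{st}$, where $\sup_{s\ne t}|\mathbb E_{st}|/|t-s|^{1+\alpha}<\infty$. *)

theory Defs
  imports "HOL-Analysis.Analysis"
begin

type_synonym heis = "real \<times> real \<times> real"

definition hx1 :: "heis \<Rightarrow> real" where "hx1 x = fst x"
definition hx2 :: "heis \<Rightarrow> real" where "hx2 x = fst (snd x)"
definition hx3 :: "heis \<Rightarrow> real" where "hx3 x = snd (snd x)"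

definition hmul :: "heis \<Rightarrow> heis \<Rightarrow> heis" where
  "hmul x y = (hx1 x + hx1 y, hx2 x + hx2 y,
               hx3 x + hx3 y + hx1 x * hx2 y - hx2 x * hx1 y)"

definition hinv :: "heis \<Rightarrow> heis" where "hinv x = - x"

definition hhor :: "heis \<Rightarrow> real^2" where "hhor x = vector [hx1 x, hx2 x]"
definition hver :: "heis \<Rightarrow> real" where "hver x = hx3 x"

definition hdil :: "real \<Rightarrow> heis \<Rightarrow> heis" where
  "hdil r x = (r * hx1 x, r * hx2 x, r\<^sup>2 * hx3 x)"

definition homog_dist :: "(heis \<Rightarrow> heis \<Rightarrow> real) \<Rightarrow> bool" where
  "homog_dist d \<longleftrightarrow>
     (\<forall>x y. d x y = 0 \<longleftrightarrow> x = y) \<and>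
     (\<forall>x y. d x y = d y x) \<and>
     (\<forall>x y z. d x z \<le> d x y + d y z) \<and>
     (\<forall>x y z. d (hmul z x) (hmul z y) = d x y) \<and>
     (\<forall>r x y. r > 0 \<longrightarrow> d (hdil r x) (hdil r y) = r * d x y)"

definition hball :: "(heis \<Rightarrow> heis \<Rightarrow> real) \<Rightarrow> heis \<Rightarrow> real \<Rightarrow> heis set" where
  "hball d x r = {y. d x y < r}"

text \<open>X_1 F(x) = d/dt F(x (t,0,0)) at t = 0, X_2 F(x) = d/dt F(x (0,t,0)) at t = 0.
  Along these curves X_1 = d_1 - x^2 d_3 and X_2 = d_2 + x^1 d_3.\<close>
definition X1_exists :: "(heis \<Rightarrow> real^2) \<Rightarrow> heis \<Rightarrow> bool" where
  "X1_exists F x \<longleftrightarrow> (\<lambda>t. F (hmul x (t, 0, 0))) differentiable (at 0)"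
definition X2_exists :: "(heis \<Rightarrow> real^2) \<Rightarrow> heis \<Rightarrow> bool" where
  "X2_exists F x \<longleftrightarrow> (\<lambda>t. F (hmul x (0, t, 0))) differentiable (at 0)"

definition X1 :: "(heis \<Rightarrow> real^2) \<Rightarrow> heis \<Rightarrow> real^2" where
  "X1 F x = vector_derivative (\<lambda>t. F (hmul x (t, 0, 0))) (at 0)"
definition X2 :: "(heis \<Rightarrow> real^2) \<Rightarrow> heis \<Rightarrow> real^2" where
  "X2 F x = vector_derivative (\<lambda>t. F (hmul x (0, t, 0))) (at 0)"

definition gradh :: "(heis \<Rightarrow> real^2) \<Rightarrow> heis \<Rightarrow> real^2^2" where
  "gradh F x = (\<chi> i j. if j = 1 then X1 F x $ i else X2 F x $ i)"

definition hbounded :: "(heis \<Rightarrow> heis \<Rightarrow> real) \<Rightarrow> heis set \<Rightarrow> bool" where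
  "hbounded d S \<longleftrightarrow> (\<exists>c r. S \<subseteq> hball d c r)"

definition C1alpha_h :: "(heis \<Rightarrow> heis \<Rightarrow> real) \<Rightarrow> real \<Rightarrow> (heis \<Rightarrow> real^2) \<Rightarrow> bool" where
  "C1alpha_h d \<alpha> F \<longleftrightarrow>
     (\<forall>x. X1_exists F x \<and> X2_exists F x) \<and>
     (\<forall>S. hbounded d S \<longrightarrow>
        (\<exists>C. \<forall>x\<in>S. \<forall>y\<in>S. norm (gradh F x - gradh F y) \<le> C * d x y powr \<alpha>))"

definition nondegenerate :: "(heis \<Rightarrow> real^2) \<Rightarrow> heis \<Rightarrow> bool" where
  "nondegenerate F p \<longleftrightarrow> invertible (gradh F p)"

definition Rem :: "(heis \<Rightarrow> real^2) \<Rightarrow> heis \<Rightarrow> heis \<Rightarrow> real^2" where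
  "Rem F x y = F y - F x - gradh F x *v hhor (hmul (hinv x) y)"

definition hcontinuous_on :: "(heis \<Rightarrow> heis \<Rightarrow> real) \<Rightarrow> real set \<Rightarrow> (real \<Rightarrow> heis) \<Rightarrow> bool" where
  "hcontinuous_on d I \<gamma> \<longleftrightarrow>
     (\<forall>t\<in>I. \<forall>e>0. \<exists>\<eta>>0. \<forall>s\<in>I. \<bar>s - t\<bar> < \<eta> \<longrightarrow> d (\<gamma> s) (\<gamma> t) < e)"

definition LSDE :: "(heis \<Rightarrow> heis \<Rightarrow> real) \<Rightarrow> real \<Rightarrow> (heis \<Rightarrow> real^2) \<Rightarrow> heis
                     \<Rightarrow> real set \<Rightarrow> (real \<Rightarrow> heis) \<Rightarrow> bool" where
  "LSDE d \<alpha> F p I \<gamma> \<longleftrightarrow>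
     is_interval I \<and> hcontinuous_on d I \<gamma> \<and>
     (\<forall>s\<in>I. \<forall>t\<in>I. hhor (hmul (hinv (\<gamma> s)) (\<gamma> t)) =
         - (matrix_inv (gradh F p) *v (Rem F p (\<gamma> t) - Rem F p (\<gamma> s)))) \<and>
     (\<exists>E::real \<Rightarrow> real \<Rightarrow> real.
        (\<forall>s\<in>I. \<forall>t\<in>I. hver (hmul (hinv (\<gamma> s)) (\<gamma> t)) = t - s + E s t) \<and>
        (\<exists>C. \<forall>s\<in>I. \<forall>t\<in>I. s \<noteq> t \<longrightarrow> \<bar>E s t\<bar> \<le> C * \<bar>t - s\<bar> powr (1 + \<alpha>)))"

end

theory Submission
  imports Defs
begin

text \<open>The horizontal equation of the LSDE says exactly that \<open>F\<close> is constant along \<open>\<gamma>\<close>, so what is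
  needed is a parametrization of the level set through \<open>q\<close> for which the vertical displacement
  \<open>\<omega>(x, y) = (x\<^sup>-\<^sup>1 y)\<^sup>v\<close> satisfies \<open>\<omega>(\<gamma>\<^sub>s, \<gamma>\<^sub>t) = t - s + O(|t - s|\<^sup>1\<^sup>+\<^sup>\<alpha>)\<close>.
  Taylor's formula and nondegeneracy bound horizontal displacements inside a level set by
  \<open>|\<omega>|\<close> to the power \<open>(1 + \<alpha>)/2\<close>. Since \<open>\<omega>\<close> is additive up to the area spanned by two horizontal
  displacements, it is almost additive along the level set, with an error of order \<open>1 + \<alpha> > 1\<close>.
  By Brouwer's theorem one can move inside the level set by any small prescribed vertical
  displacement; iterating equal steps gives discrete curves, which the sewing argument controls
  uniformly in the step size, and a pointwise cluster point of them is \<open>\<gamma>\<close>. Finally \<open>\<gamma>\<close> exhausts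
  the level set near \<open>p\<close> by the intermediate value theorem, because \<open>\<omega>\<close> vanishes on no pair of
  distinct points of the level set.\<close>

section \<open>The Heisenberg group and its homogeneous distances\<close>

lemmas heis_simps = hmul_def hinv_def hx1_def hx2_def hx3_def

section \<open>Algebra of the group and of vertical displacements\<close>

lemma hmul_assoc: "hmul (hmul x y) z = hmul x (hmul y z)"
  by (simp add: heis_simps algebra_simps)

lemma hmul_0_left [simp]: "hmul 0 x = x"
  and hmul_0_right [simp]: "hmul x 0 = x"
  by (simp_all add: heis_simps)

lemma hmul_hinv_left [simp]: "hmul (hinv x) x = 0"
  and hmul_hinv_right [simp]: "hmul x (hinv x) = 0"
  by (simp_all add: heis_simps zero_prod_def)

lemma hmul_hinv_cancel [simp]: "hmul (hinv x) (hmul x y) = y"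
  and hmul_hinv_cancel' [simp]: "hmul x (hmul (hinv x) y) = y"
  by (simp_all add: hmul_assoc [symmetric])

lemma hinv_hmul_swap: "hinv (hmul (hinv x) y) = hmul (hinv y) x"
  by (simp add: heis_simps)

text \<open>The area form of the plane: the cocycle by which the third coordinate fails to be
  additive under \<open>hmul\<close>.\<close>

definition wedge :: "real^2 \<Rightarrow> real^2 \<Rightarrow> real" where
  "wedge a b = a $ 1 * b $ 2 - a $ 2 * b $ 1"

lemma abs_wedge_le: "\<bar>wedge a b\<bar> \<le> norm a * norm b"
proof -
  have "(wedge a b)\<^sup>2 \<le> (norm a * norm b)\<^sup>2"
  proof -
    \<comment> \<open>Lagrange's identity in the plane.\<close>
    have "(norm a * norm b)\<^sup>2 - (wedge a b)\<^sup>2 = (a $ 1 * b $ 1 + a $ 2 * b $ 2)\<^sup>2"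
      unfolding power_mult_distrib power2_norm_eq_inner
      by (simp add: wedge_def inner_vec_def sum_2 power2_eq_square algebra_simps)
    then show ?thesis
      by (metis diff_ge_0_iff_ge zero_le_power2)
  qed
  then show ?thesis
    by (simp add: abs_le_square_iff [symmetric] abs_mult)
qed

lemma hhor_component [simp]: "hhor x $ 1 = fst x" "hhor x $ 2 = fst (snd x)"
  by (simp_all add: hhor_def hx1_def hx2_def)

lemma vec2_eqI: "a $ 1 = b $ 1 \<Longrightarrow> a $ 2 = b $ 2 \<Longrightarrow> a = (b::real^2)"
  by (simp add: vec_eq_iff forall_2)

lemma hhor_hmul: "hhor (hmul x y) = hhor x + hhor y"
  by (rule vec2_eqI) (simp_all add: heis_simps)

lemma hhor_diff: "hhor (hmul (hinv x) y) = hhor y - hhor x"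
  by (rule vec2_eqI) (simp_all add: heis_simps)

lemma hhor_0 [simp]: "hhor 0 = 0"
  by (rule vec2_eqI) simp_all

lemma hver_hmul: "hver (hmul x y) = hver x + hver y + wedge (hhor x) (hhor y)"
  by (simp add: wedge_def heis_simps hver_def)

lemma hver_hinv: "hver (hinv x) = - hver x"
  by (simp add: heis_simps hver_def)

lemma hver_0 [simp]: "hver 0 = 0"
  by (simp add: hver_def hx3_def)

lemma hmul_hinv_split: "hmul (hinv x) z = hmul (hmul (hinv x) y) (hmul (hinv y) z)"
  by (simp add: hmul_assoc)

lemma hver_swap: "hver (hmul (hinv y) x) = - hver (hmul (hinv x) y)"
  by (metis hinv_hmul_swap hver_hinv)

text \<open>Inserting \<open>y\<close> costs the area spanned by two horizontal displacements; this
  is the defect that the sewing argument has to control.\<close>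

lemma hver_chasles:
  "hver (hmul (hinv x) z) = hver (hmul (hinv x) y) + hver (hmul (hinv y) z)
     + wedge (hhor (hmul (hinv x) y)) (hhor (hmul (hinv y) z))"
  by (subst hmul_hinv_split [of x z y]) (rule hver_hmul)

lemma heis_eq_0I: "hhor x = 0 \<Longrightarrow> hver x = 0 \<Longrightarrow> x = 0"
  using hhor_component [of x] by (simp add: hver_def hx3_def prod_eq_iff)

lemma heis_eqI:
  assumes "hhor (hmul (hinv x) y) = 0" "hver (hmul (hinv x) y) = 0" shows "x = y"
  by (metis assms heis_eq_0I hmul_0_right hmul_hinv_cancel')

lemma continuous_on_hmul [continuous_intros]:
  "continuous_on S f \<Longrightarrow> continuous_on S g \<Longrightarrow> continuous_on S (\<lambda>x. hmul (f x) (g x))"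
  unfolding heis_simps by (intro continuous_intros)

lemma continuous_on_hinv [continuous_intros]:
  "continuous_on S f \<Longrightarrow> continuous_on S (\<lambda>x. hinv (f x))"
  unfolding heis_simps by (intro continuous_intros)

lemma continuous_on_hver [continuous_intros]:
  "continuous_on S f \<Longrightarrow> continuous_on S (\<lambda>x. hver (f x))"
  unfolding hver_def hx3_def by (intro continuous_intros)

lemma hhor_eq: "hhor x = fst x *\<^sub>R axis 1 1 + fst (snd x) *\<^sub>R axis 2 1"
  by (rule vec2_eqI) (simp_all add: axis_def)

lemma continuous_on_hhor [continuous_intros]:
  "continuous_on S f \<Longrightarrow> continuous_on S (\<lambda>x. hhor (f x))"
  unfolding hhor_eq by (intro continuous_intros)

text \<open>An explicit homogeneous size function, continuous for the Euclidean topology, through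
  which the abstract \<open>d\<close> is compared with coordinates. The square root accounts for the
  weight 2 that \<open>hdil\<close> gives the vertical coordinate.\<close>

definition gauge_h :: "heis \<Rightarrow> real" where
  "gauge_h x = norm (hhor x) + sqrt \<bar>hver x\<bar>"

lemma continuous_on_gauge_h [continuous_intros]:
  "continuous_on S f \<Longrightarrow> continuous_on S (\<lambda>x. gauge_h (f x))"
  unfolding gauge_h_def by (intro continuous_intros)

lemma gauge_h_nonneg [simp]: "0 \<le> gauge_h x"
  by (simp add: gauge_h_def)

lemma gauge_h_0 [simp]: "gauge_h 0 = 0"
  by (simp add: gauge_h_def)

lemma gauge_h_eq_0_iff: "gauge_h x = 0 \<longleftrightarrow> x = 0"
proof
  assume "gauge_h x = 0"
  then have "hhor x = 0" "hver x = 0"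
    by (simp_all add: gauge_h_def add_nonneg_eq_0_iff)
  then show "x = 0"
    by (rule heis_eq_0I)
qed simp

lemma norm_hhor_le_gauge_h: "norm (hhor x) \<le> gauge_h x"
  by (simp add: gauge_h_def)

lemma gauge_h_dil: "r > 0 \<Longrightarrow> gauge_h (hdil r x) = r * gauge_h x"
proof -
  assume r: "r > 0"
  have "hhor (hdil r x) = r *\<^sub>R hhor x"
    by (rule vec2_eqI) (simp_all add: hdil_def hx1_def hx2_def)
  moreover have "hver (hdil r x) = r\<^sup>2 * hver x"
    by (simp add: hdil_def hver_def hx3_def)
  ultimately show ?thesis
    using r by (simp add: gauge_h_def abs_mult real_sqrt_mult algebra_simps)
qed

lemma compact_gauge_h_ball: "compact {x. gauge_h x \<le> R}"
proof -
  have "closed {x. gauge_h x \<le> R}"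
    by (intro closed_Collect_le continuous_intros)
  moreover have "bounded {x. gauge_h x \<le> R}"
  proof (rule boundedI)
    fix x :: heis assume "x \<in> {x. gauge_h x \<le> R}"
    then have "norm (hhor x) + sqrt \<bar>hver x\<bar> \<le> R"
      by (simp add: gauge_h_def)
    moreover have "0 \<le> norm (hhor x)" "0 \<le> sqrt \<bar>hver x\<bar>"
      by simp_all
    ultimately have 1: "norm (hhor x) \<le> R" "sqrt \<bar>hver x\<bar> \<le> R"
      by linarith+
    have "\<bar>fst x\<bar> \<le> R" "\<bar>fst (snd x)\<bar> \<le> R" "\<bar>snd (snd x)\<bar> \<le> R\<^sup>2"
      using 1 component_le_norm_cart [of "hhor x" 1] component_le_norm_cart [of "hhor x" 2]
        sqrt_le_D [of "\<bar>hver x\<bar>" R]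
      by (auto simp: hver_def hx3_def)
    then show "norm x \<le> R + R + R\<^sup>2"
      using norm_Pair_le [of "fst x" "snd x"] norm_Pair_le [of "fst (snd x)" "snd (snd x)"]
      unfolding prod.collapse real_norm_def by linarith
  qed
  ultimately show ?thesis
    by (simp add: compact_eq_bounded_closed)
qed

lemma compact_gauge_h_sphere: "compact {x. gauge_h x = 1}"
proof -
  have "closed {x. gauge_h x = 1}"
    by (intro closed_Collect_eq continuous_intros)
  from compact_Int_closed [OF compact_gauge_h_ball [of 1] this] show ?thesis
    by (rule back_subst [of compact]) auto
qed

section \<open>Broken paths of axis-parallel horizontal segments\<close>

definition hor_seg :: "heis \<Rightarrow> bool" where
  "hor_seg w \<longleftrightarrow> (\<exists>t. w = (t, 0, 0) \<or> w = (0, t, 0))"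

lemma hor_seg_scaleR: "hor_seg w \<Longrightarrow> hor_seg (s *\<^sub>R w)"
  by (auto simp: hor_seg_def)

text \<open>A vertical displacement by \<open>2 s t\<close> is the commutator of horizontal displacements
  by \<open>s\<close> and \<open>t\<close>.\<close>
lemma hor_seg_decomposition:
  obtains ws where "\<forall>w\<in>set ws. hor_seg w" "foldr hmul ws 0 = x"
    "(\<Sum>w\<leftarrow>ws. norm w) \<le> 6 * gauge_h x"
proof -
  obtain a b c where x: "x = (a, b, c)"
    by (cases x) auto
  \<comment> \<open>The first two segments reach height \<open>a * b\<close>; the missing height
    \<open>e\<close> comes from a commutator with two sides of equal length, the sign of
    \<open>e\<close> being carried by \<open>t\<close>.\<close>
  define e where "e = c - a * b"
  define s where "s = sqrt (\<bar>e\<bar> / 2)"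
  define t where "t = sgn e * s"
  have st: "2 * s * t = e"
  proof -
    have "2 * s * t = sgn e * (2 * (s * s))" by (simp add: t_def)
    also have "2 * (s * s) = \<bar>e\<bar>" by (simp add: s_def)
    finally show ?thesis by (simp only: mult_sgn_abs)
  qed
  define ws where "ws = [(a,0,0), (0,b,0), (s,0,0), (0,t,0), (-s,0,0), (0,-t,0)::heis]"
  have "\<forall>w\<in>set ws. hor_seg w"
    by (auto simp: ws_def hor_seg_def)
  moreover have "foldr hmul ws 0 = x"
    using st by (simp add: ws_def heis_simps x e_def algebra_simps)
  \<comment> \<open>Each of the six segments is at most as long as the gauge. For \<open>s\<close>
    and \<open>t\<close> this rests on |e| <= |c| + |a b|, where |a b| is at most half the squared
    horizontal norm.\<close>
  moreover have "(\<Sum>w\<leftarrow>ws. norm w) \<le> 6 * gauge_h x"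
  proof -
    let ?K = "gauge_h x"
    have ab: "\<bar>a\<bar> \<le> norm (hhor x)" "\<bar>b\<bar> \<le> norm (hhor x)"
      using component_le_norm_cart [of "hhor x" 1] component_le_norm_cart [of "hhor x" 2]
      by (auto simp: x)
    have "(norm (hhor x))\<^sup>2 = a\<^sup>2 + b\<^sup>2"
      unfolding power2_norm_eq_inner
      by (simp add: inner_vec_def sum_2 x power2_eq_square)
    then have "2 * \<bar>a * b\<bar> \<le> (norm (hhor x))\<^sup>2"
      using zero_le_power2 [of "\<bar>a\<bar> - \<bar>b\<bar>"] by (simp add: power2_eq_square abs_mult algebra_simps)
    moreover have "\<bar>c\<bar> = (sqrt \<bar>hver x\<bar>)\<^sup>2"
      by (simp add: x hver_def hx3_def)
    moreover have "(norm (hhor x))\<^sup>2 + (sqrt \<bar>hver x\<bar>)\<^sup>2 \<le> ?K\<^sup>2"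
      by (simp add: gauge_h_def power2_sum)
    ultimately have "\<bar>e\<bar> \<le> ?K\<^sup>2"
      unfolding e_def by (smt (verit) zero_le_power2)
    then have "s \<le> sqrt (?K\<^sup>2)"
      unfolding s_def by (intro real_sqrt_le_mono) (simp add: field_simps)
    then have "s \<le> ?K" by simp
    moreover have "0 \<le> s" by (simp add: s_def)
    moreover have "\<bar>t\<bar> \<le> s"
      using \<open>0 \<le> s\<close> by (simp add: t_def abs_mult abs_sgn_eq)
    moreover have "norm (hhor x) \<le> ?K"
      by (rule norm_hhor_le_gauge_h)
    ultimately show ?thesis
      using ab by (simp add: ws_def norm_Pair)
  qed
  ultimately show thesis
    by (rule that)
qed

text \<open>Bridges to the Euclidean topology: the gauge of \<open>hmul (hinv x) y\<close> is
  continuous in \<open>y\<close> and vanishes at \<open>y = x\<close>. It serves both for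
  \<open>d\<close> and for the chart \<open>f\<close>.\<close>

lemma continuous_on_lipschitz_gauge_h:
  fixes g :: "heis \<Rightarrow> 'b::metric_space"
  assumes "\<And>x y. x \<in> S \<Longrightarrow> y \<in> S \<Longrightarrow> dist (g y) (g x) \<le> C * gauge_h (hmul (hinv x) y)"
  shows "continuous_on S g"
  unfolding continuous_on_def
proof
  fix x assume x: "x \<in> S"
  have "continuous_on S (\<lambda>y. C * gauge_h (hmul (hinv x) y))"
    by (intro continuous_intros)
  then have "((\<lambda>y. C * gauge_h (hmul (hinv x) y)) \<longlongrightarrow> C * gauge_h (hmul (hinv x) x)) (at x within S)"
    using x unfolding continuous_on_def by blast
  then have lim: "((\<lambda>y. C * gauge_h (hmul (hinv x) y)) \<longlongrightarrow> 0) (at x within S)"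
    by simp
  have "eventually (\<lambda>y. dist (g y) (g x) \<le> C * gauge_h (hmul (hinv x) y)) (at x within S)"
    using assms x by (auto simp: eventually_at intro!: exI [of _ 1])
  then have "((\<lambda>y. dist (g y) (g x)) \<longlongrightarrow> 0) (at x within S)"
    by (intro tendsto_sandwich [OF always_eventually _ tendsto_const lim]) auto
  then show "(g \<longlongrightarrow> g x) (at x within S)"
    by (rule tendsto_dist_iff [THEN iffD2])
qed

section \<open>Comparison of a homogeneous distance with the gauge\<close>

locale homog =
  fixes d :: "heis \<Rightarrow> heis \<Rightarrow> real"
  assumes homog: "homog_dist d"
begin

lemma d_eq_0: "d x y = 0 \<longleftrightarrow> x = y"
  and d_sym: "d x y = d y x"
  and d_triangle: "d x z \<le> d x y + d y z"
  and d_left: "d (hmul z x) (hmul z y) = d x y"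
  and d_dil: "r > 0 \<Longrightarrow> d (hdil r x) (hdil r y) = r * d x y"
  using homog unfolding homog_dist_def by blast+

lemma d_self [simp]: "d x x = 0"
  by (simp add: d_eq_0)

lemma d_nonneg [simp]: "0 \<le> d x y"
  using d_triangle [of x x y] d_sym [of x y] by simp

lemma d_eq: "d x y = d 0 (hmul (hinv x) y)"
  using d_left [of "hinv x" x y] by simp

lemma d_hmul [simp]: "d x (hmul x w) = d 0 w"
  using d_left [of x 0 w] by simp

lemma d_hor_seg: "\<exists>c>0. \<forall>w. hor_seg w \<longrightarrow> d 0 w \<le> c * norm w"
proof -
  \<comment> \<open>Dilations give positive factors; the sign is removed by left translation by
    \<open>(a, b, 0)\<close>, the inverse of \<open>(-a, -b, 0)\<close>.\<close>
  have scale: "d 0 (t * a, t * b, 0) = \<bar>t\<bar> * d 0 (a, b, 0)" for t a b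
  proof -
    have pos: "d 0 (t * a, t * b, 0) = t * d 0 (a, b, 0)" if "t > 0" for t a b
      using d_dil [OF that, of 0 "(a, b, 0)"] by (simp add: hdil_def heis_simps zero_prod_def)
    have neg: "d 0 (- a, - b, 0) = d 0 (a, b, 0)" for a b
      using d_left [of "(a, b, 0)" 0 "(-a, -b, 0)"] d_sym [of 0 "(a,b,0)"]
      by (simp add: heis_simps zero_prod_def)
    show ?thesis
    proof (cases "t > 0 \<or> t = 0")
      case True then show ?thesis using pos by (auto simp: zero_prod_def [symmetric])
    next
      case False
      then have "d 0 (t * a, t * b, 0) = (- t) * d 0 (- a, - b, 0)"
        using pos [of "-t" "-a" "-b"] by simp
      with False neg show ?thesis by simp
    qed
  qed
  define c where "c = 1 + d 0 (1, 0, 0) + d 0 (0, 1, 0)"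
  have "c > 0"
    using d_nonneg [of 0 "(1,0,0)"] d_nonneg [of 0 "(0,1,0)"] unfolding c_def by linarith
  moreover have "d 0 w \<le> c * norm w" if "hor_seg w" for w
  proof -
    from that obtain t where "w = (t, 0, 0) \<or> w = (0, t, 0)"
      by (auto simp: hor_seg_def)
    then have "d 0 w = norm w * d 0 (1, 0, 0) \<or> d 0 w = norm w * d 0 (0, 1, 0)"
      using scale [of t 1 0] scale [of t 0 1] by (auto simp: norm_Pair)
    moreover have "norm w * d 0 (1, 0, 0) \<le> norm w * c" "norm w * d 0 (0, 1, 0) \<le> norm w * c"
      by (intro mult_left_mono; simp add: c_def)+
    ultimately show ?thesis
      by (auto simp: mult.commute)
  qed
  ultimately show ?thesis by blast
qed

lemma d_hor_path:
  assumes c: "\<And>w. hor_seg w \<Longrightarrow> d 0 w \<le> c * norm w"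
    and "\<forall>w\<in>set ws. hor_seg w"
  shows "d 0 (foldr hmul ws 0) \<le> c * (\<Sum>w\<leftarrow>ws. norm w)"
  using assms(2)
proof (induction ws)
  case (Cons w ws)
  have "d 0 (hmul w (foldr hmul ws 0)) \<le> d 0 w + d 0 (foldr hmul ws 0)"
    using d_triangle [of 0 "hmul w (foldr hmul ws 0)" w] by simp
  then show ?case
    using Cons c [of w] by (auto simp: algebra_simps)
qed auto

text \<open>Continuity of \<open>d\<close> is not among the axioms, so this bound is algebraic: a
  displacement is a product of six horizontal segments, whose lengths add up by left invariance and
  the triangle inequality. Continuity of \<open>d\<close> is then a consequence.\<close>

lemma d_le_gauge_h: "\<exists>c>0. \<forall>x y. d x y \<le> c * gauge_h (hmul (hinv x) y)"
proof -
  obtain c where c: "c > 0" "\<And>w. hor_seg w \<Longrightarrow> d 0 w \<le> c * norm w"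
    using d_hor_seg by blast
  have "d 0 z \<le> (c * 6) * gauge_h z" for z
  proof -
    obtain ws where ws: "\<forall>w\<in>set ws. hor_seg w" "foldr hmul ws 0 = z"
      "(\<Sum>w\<leftarrow>ws. norm w) \<le> 6 * gauge_h z"
      by (rule hor_seg_decomposition)
    have "d 0 z \<le> c * (\<Sum>w\<leftarrow>ws. norm w)"
      using d_hor_path [OF c(2) ws(1)] ws(2) by simp
    also have "\<dots> \<le> c * (6 * gauge_h z)"
      using ws(3) c(1) by (intro mult_left_mono) auto
    finally show ?thesis by simp
  qed
  then have "d x y \<le> (c * 6) * gauge_h (hmul (hinv x) y)" for x y
    unfolding d_eq [of x y] .
  then show ?thesis
    using c(1) by (intro exI [of _ "c * 6"]) simp
qed

lemma continuous_on_d: "continuous_on S (d a)"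
proof -
  obtain c where c: "c > 0" "\<forall>x y. d x y \<le> c * gauge_h (hmul (hinv x) y)"
    using d_le_gauge_h by blast
  show ?thesis
  proof (rule continuous_on_lipschitz_gauge_h)
    fix x y
    have "dist (d a y) (d a x) \<le> d x y"
      using d_triangle [of a y x] d_triangle [of a x y] d_sym [of x y]
      by (simp add: dist_real_def)
    with c show "dist (d a y) (d a x) \<le> c * gauge_h (hmul (hinv x) y)"
      by (meson order_trans)
  qed
qed

text \<open>The continuous function \<open>d 0\<close> has a positive minimum on the compact unit
  sphere of the gauge, and dilations carry the bound to all points.\<close>

lemma gauge_h_le_d: "\<exists>c>0. \<forall>x y. gauge_h (hmul (hinv x) y) \<le> c * d x y"
proof -
  let ?S = "{x. gauge_h x = 1}"
  have "(0, 0, 1) \<in> ?S"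
    by (simp add: gauge_h_def hhor_eq hver_def hx3_def)
  then have "?S \<noteq> {}" by blast
  then obtain x0 where x0: "x0 \<in> ?S" "\<And>x. x \<in> ?S \<Longrightarrow> d 0 x0 \<le> d 0 x"
    using continuous_attains_inf [OF compact_gauge_h_sphere _ continuous_on_d, of 0] by blast
  define m where "m = d 0 x0"
  have m: "m > 0"
    using x0(1) d_eq_0 [of 0 x0] d_nonneg [of 0 x0] unfolding m_def
    by (metis gauge_h_0 less_eq_real_def mem_Collect_eq zero_neq_one)
  have "m * gauge_h x \<le> d 0 x" for x
  proof (cases "x = 0")
    case False
    define r where "r = gauge_h x"
    have r: "r > 0"
      using False gauge_h_eq_0_iff [of x] gauge_h_nonneg [of x] unfolding r_def by linarith
    define y where "y = hdil (1 / r) x"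
    have x: "x = hdil r y"
      using r by (simp add: y_def hdil_def heis_simps power2_eq_square prod_eq_iff)
    have "gauge_h y = 1"
      using r unfolding y_def by (subst gauge_h_dil) (auto simp: r_def)
    then have "m \<le> d 0 y"
      using x0 by (simp add: m_def)
    moreover have "d 0 x = r * d 0 y"
      using d_dil [OF r, of 0 y] by (simp add: x hdil_def heis_simps zero_prod_def)
    ultimately show ?thesis
      using r unfolding r_def by (simp add: mult.commute)
  qed simp
  then have "gauge_h (hmul (hinv x) y) \<le> (1 / m) * d x y" for x y
    using m d_eq [of x y] by (simp add: field_simps)
  then show ?thesis
    using m by (intro exI [of _ "1 / m"]) auto
qed

end

section \<open>Taylor expansion along horizontal segments\<close>

text \<open>The norm of a matrix is here the Frobenius norm, so Cauchy-Schwarz applies row by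
  row.\<close>

lemma norm_matrix_vector_mult_le:
  fixes A :: "real^'n^'m"
  shows "norm (A *v x) \<le> norm A * norm x"
proof -
  have "norm (A *v x) = L2_set (\<lambda>i. \<bar>A $ i \<bullet> x\<bar>) UNIV"
    by (simp add: norm_vec_def matrix_mult_dot)
  also have "\<dots> \<le> L2_set (\<lambda>i. norm (A $ i) * norm x) UNIV"
    by (intro L2_set_mono) (auto simp: Cauchy_Schwarz_ineq2)
  also have "\<dots> = norm A * norm x"
    by (simp add: norm_vec_def L2_set_left_distrib)
  finally show ?thesis .
qed

lemma has_vector_derivative_hor_seg:
  assumes "\<forall>x. X1_exists F x \<and> X2_exists F x" and "hor_seg w"
  shows "((\<lambda>s. F (hmul x (s *\<^sub>R w))) has_vector_derivative
           gradh F (hmul x (s *\<^sub>R w)) *v hhor w) (at s)"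
proof -
  have D: "((\<lambda>h. F (hmul y (h *\<^sub>R w))) has_vector_derivative gradh F y *v hhor w) (at 0)" for y
  proof -
    obtain t where t: "w = (t, 0, 0) \<or> w = (0, t, 0)"
      using assms(2) by (auto simp: hor_seg_def)
    have "((\<lambda>h. h * t) has_real_derivative t) (at 0)"
      by (auto intro!: derivative_eq_intros)
    then have lin: "((\<lambda>h. h * t) has_vector_derivative t) (at 0)"
      by (simp add: has_real_derivative_iff_has_vector_derivative)
    from t show ?thesis
    proof
      assume w: "w = (t, 0, 0)"
      have "((\<lambda>t. F (hmul y (t, 0, 0))) has_vector_derivative X1 F y) (at (0 * t))"
        using assms(1) [rule_format, of y] by (simp add: X1_exists_def X1_def vector_derivative_works [symmetric])
      from vector_diff_chain_at [OF lin this]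
      have "((\<lambda>h. F (hmul y (h * t, 0, 0))) has_vector_derivative t *\<^sub>R X1 F y) (at 0)"
        by (simp add: o_def)
      moreover have "gradh F y *v hhor w = t *\<^sub>R X1 F y"
        by (rule vec2_eqI) (simp_all add: gradh_def matrix_vector_mult_def sum_2 w)
      ultimately show ?thesis by (simp add: w)
    next
      assume w: "w = (0, t, 0)"
      have "((\<lambda>t. F (hmul y (0, t, 0))) has_vector_derivative X2 F y) (at (0 * t))"
        using assms(1) [rule_format, of y] by (simp add: X2_exists_def X2_def vector_derivative_works [symmetric])
      from vector_diff_chain_at [OF lin this]
      have "((\<lambda>h. F (hmul y (0, h * t, 0))) has_vector_derivative t *\<^sub>R X2 F y) (at 0)"
        by (simp add: o_def)
      moreover have "gradh F y *v hhor w = t *\<^sub>R X2 F y"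
        by (rule vec2_eqI) (simp_all add: gradh_def matrix_vector_mult_def sum_2 w)
      ultimately show ?thesis by (simp add: w)
    qed
  qed
  \<comment> \<open>The multiples of \<open>w\<close> form a one-parameter subgroup, so the
    derivative at \<open>s\<close> is the derivative at 0 with base point moved to
    \<open>hmul x (s *\<^sub>R w)\<close>.\<close>
  have eq: "hmul (hmul x (s *\<^sub>R w)) ((u - s) *\<^sub>R w) = hmul x (u *\<^sub>R w)" for u
    using assms(2) by (auto simp: hor_seg_def heis_simps algebra_simps)
  have "((\<lambda>u. u - s) has_vector_derivative 1) (at s)"
    by (auto intro!: derivative_eq_intros)
  moreover have "((\<lambda>h. F (hmul (hmul x (s *\<^sub>R w)) (h *\<^sub>R w))) has_vector_derivative
      gradh F (hmul x (s *\<^sub>R w)) *v hhor w) (at (s - s))"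
    using D [of "hmul x (s *\<^sub>R w)"] by simp
  ultimately have "((\<lambda>h. F (hmul (hmul x (s *\<^sub>R w)) (h *\<^sub>R w))) \<circ> (\<lambda>u. u - s)
      has_vector_derivative 1 *\<^sub>R (gradh F (hmul x (s *\<^sub>R w)) *v hhor w)) (at s)"
    by (rule vector_diff_chain_at)
  then show ?thesis
    by (simp only: o_def eq scaleR_one)
qed

text \<open>The mean value inequality, after subtracting the linear motion prescribed by
  \<open>A\<close> from \<open>F\<close> along the segment.\<close>

lemma hor_seg_increment:
  assumes F: "\<forall>x. X1_exists F x \<and> X2_exists F x" and w: "hor_seg w"
    and B: "\<And>s. s \<in> {0..1} \<Longrightarrow> norm (gradh F (hmul x (s *\<^sub>R w)) - A) \<le> B"
  shows "norm (F (hmul x w) - F x - A *v hhor w) \<le> B * norm w"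
proof -
  define g where "g s = F (hmul x (s *\<^sub>R w)) - s *\<^sub>R (A *v hhor w)" for s :: real
  have g: "(g has_vector_derivative
        gradh F (hmul x (s *\<^sub>R w)) *v hhor w - A *v hhor w) (at s within {0..1})" for s
  proof -
    have "((\<lambda>s. s *\<^sub>R (A *v hhor w)) has_vector_derivative A *v hhor w) (at s within {0..1})"
      using has_vector_derivative_scaleR [OF DERIV_ident has_vector_derivative_const]
      by (simp add: has_real_derivative_iff_has_vector_derivative)
    then show ?thesis
      unfolding g_def
      by (rule has_vector_derivative_diff
          [OF has_vector_derivative_at_within [OF has_vector_derivative_hor_seg [OF F w]]])
  qed
  have nw: "norm (hhor w) = norm w"
    using w by (auto simp: hor_seg_def hhor_eq norm_Pair)
  have "norm (g 1 - g 0) \<le> (B * norm w) * norm (1 - 0 :: real)"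
  proof (rule differentiable_bound [of "{0..1}"])
    fix s :: real assume s: "s \<in> {0..1}"
    show "(g has_derivative (\<lambda>h. h *\<^sub>R (gradh F (hmul x (s *\<^sub>R w)) *v hhor w - A *v hhor w)))
            (at s within {0..1})"
      using g by (simp add: has_vector_derivative_def)
    have "norm ((gradh F (hmul x (s *\<^sub>R w)) - A) *v hhor w) \<le> B * norm (hhor w)"
      by (rule order_trans [OF norm_matrix_vector_mult_le]) (intro mult_right_mono B s norm_ge_zero)
    then show "onorm (\<lambda>h. h *\<^sub>R (gradh F (hmul x (s *\<^sub>R w)) *v hhor w - A *v hhor w)) \<le> B * norm w"
      by (subst onorm_scaleR_left) 
        (simp_all add: onorm_id bounded_linear_ident nw matrix_vector_mult_diff_rdistrib)
  qed auto
  then show ?thesis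
    by (simp add: g_def algebra_simps)
qed

lemma matrix_inv_mult:
  assumes "invertible A"
  shows "matrix_inv A ** A = mat 1" "A ** matrix_inv A = mat 1"
proof -
  have "A ** matrix_inv A = mat 1 \<and> matrix_inv A ** A = mat 1"
    using assms unfolding invertible_def matrix_inv_def by (rule someI_ex)
  then show "matrix_inv A ** A = mat 1" "A ** matrix_inv A = mat 1"
    by simp_all
qed

context homog
begin

text \<open>The matrix \<open>A\<close> is the same on all segments and \<open>hhor\<close> is
  additive, so the linear terms add up to the one of the endpoint. The whole path stays within
  \<open>c\<close> times its length from \<open>x\<close>, where the gradient is assumed close to
  \<open>A\<close>.\<close>

lemma hor_path_increment:
  assumes F: "\<forall>x. X1_exists F x \<and> X2_exists F x"
    and c: "c > 0" "\<And>w. hor_seg w \<Longrightarrow> d 0 w \<le> c * norm w"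
    and "\<forall>w\<in>set ws. hor_seg w"
    and "\<And>y. d x y \<le> c * (\<Sum>w\<leftarrow>ws. norm w) \<Longrightarrow> norm (gradh F y - A) \<le> B"
  shows "norm (F (hmul x (foldr hmul ws 0)) - F x - A *v hhor (foldr hmul ws 0))
           \<le> B * (\<Sum>w\<leftarrow>ws. norm w)"
  using assms(4,5)
proof (induction ws arbitrary: x)
  case (Cons w ws)
  let ?z = "foldr hmul ws 0"
  have w: "hor_seg w" using Cons.prems by simp
  have nn: "0 \<le> (\<Sum>w\<leftarrow>ws. norm w)"
    by (intro sum_list_nonneg) auto
  have "norm (F (hmul (hmul x w) ?z) - F (hmul x w) - A *v hhor ?z) \<le> B * (\<Sum>w\<leftarrow>ws. norm w)"
  proof (rule Cons.IH)
    show "\<forall>w\<in>set ws. hor_seg w" using Cons.prems by simp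
    fix y assume "d (hmul x w) y \<le> c * (\<Sum>w\<leftarrow>ws. norm w)"
    then have "d x y \<le> c * (\<Sum>w\<leftarrow>w # ws. norm w)"
      using d_triangle [of x y "hmul x w"] c(2) [OF w] by (simp add: algebra_simps)
    then show "norm (gradh F y - A) \<le> B"
      by (rule Cons.prems(2))
  qed
  moreover have "norm (F (hmul x w) - F x - A *v hhor w) \<le> B * norm w"
  proof (rule hor_seg_increment [OF F w])
    fix s :: real assume s: "s \<in> {0..1}"
    have "d 0 (s *\<^sub>R w) \<le> c * (s * norm w)"
      using c(2) [OF hor_seg_scaleR [OF w], of s] s by simp
    also have "\<dots> \<le> c * (1 * norm w)"
      using s c(1) by (intro mult_left_mono mult_right_mono) auto
    also have "\<dots> \<le> c * (\<Sum>w\<leftarrow>w # ws. norm w)"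
      using nn c(1) by simp
    finally show "norm (gradh F (hmul x (s *\<^sub>R w)) - A) \<le> B"
      using Cons.prems(2) by simp
  qed
  ultimately have "norm ((F (hmul (hmul x w) ?z) - F (hmul x w) - A *v hhor ?z)
      + (F (hmul x w) - F x - A *v hhor w)) \<le> B * (\<Sum>w\<leftarrow>ws. norm w) + B * norm w"
    by (rule norm_triangle_mono)
  then show ?case
    by (simp add: hhor_hmul hmul_assoc matrix_vector_right_distrib algebra_simps)
qed simp

text \<open>Along a broken path from \<open>x\<close> to \<open>y\<close> of length comparable to
  \<open>d x y\<close>, the gradient differs from \<open>gradh F x\<close> by
  O(\<open>d x y powr \<alpha>\<close>); multiplying by the length gives the order 1 +
  \<alpha>.\<close>

lemma taylor:
  assumes F: "C1alpha_h d \<alpha> F" and \<alpha>: "0 < \<alpha>"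
  shows "\<exists>C>0. \<forall>x\<in>hball d p 1. \<forall>y\<in>hball d p 1.
     norm (F y - F x - gradh F x *v hhor (hmul (hinv x) y)) \<le> C * d x y powr (1 + \<alpha>)"
proof -
  obtain c where c: "c > 0" "\<And>w. hor_seg w \<Longrightarrow> d 0 w \<le> c * norm w"
    using d_hor_seg by blast
  obtain k where k: "k > 0" "\<And>x y. gauge_h (hmul (hinv x) y) \<le> k * d x y"
    using gauge_h_le_d by blast
  \<comment> \<open>The path may leave the unit ball: its points lie within
    \<open>m * d x y\<close>, hence within \<open>2 * m\<close>, of \<open>x\<close>, so the Hoelder
    bound is taken on a larger ball.\<close>
  define R where "R = c * (6 * k * 2) + 2"
  have "hbounded d (hball d p R)"
    unfolding hbounded_def by blast
  then obtain C0 where C0: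
    "\<And>x y. x \<in> hball d p R \<Longrightarrow> y \<in> hball d p R \<Longrightarrow>
       norm (gradh F x - gradh F y) \<le> C0 * d x y powr \<alpha>"
    using F unfolding C1alpha_h_def by meson
  define C1 where "C1 = \<bar>C0\<bar> + 1"
  define m where "m = c * (6 * k)"
  have m: "m > 0" using c k by (simp add: m_def)
  define C where "C = C1 * m powr \<alpha> * (6 * k)"
  have "norm (F y - F x - gradh F x *v hhor (hmul (hinv x) y)) \<le> C * d x y powr (1 + \<alpha>)"
    if x: "x \<in> hball d p 1" and y: "y \<in> hball d p 1" for x y
  proof -
    have pxy: "d p x < 1" "d p y < 1" using x y by (auto simp: hball_def)
    have dxy: "d x y < 2"
      using d_triangle [of x y p] d_sym [of x p] pxy by simp
    let ?z = "hmul (hinv x) y"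
    obtain ws where ws: "\<forall>w\<in>set ws. hor_seg w" "foldr hmul ws 0 = ?z"
      "(\<Sum>w\<leftarrow>ws. norm w) \<le> 6 * gauge_h ?z"
      by (rule hor_seg_decomposition)
    have le: "(\<Sum>w\<leftarrow>ws. norm w) \<le> 6 * k * d x y"
      using ws(3) k(2) [of x y] by simp
    let ?B = "C1 * (m * d x y) powr \<alpha>"
    have "norm (F (hmul x (foldr hmul ws 0)) - F x - gradh F x *v hhor (foldr hmul ws 0))
           \<le> ?B * (\<Sum>w\<leftarrow>ws. norm w)"
    proof (rule hor_path_increment [OF _ c ws(1)])
      show "\<forall>x. X1_exists F x \<and> X2_exists F x"
        using F by (simp add: C1alpha_h_def)
      fix z assume "d x z \<le> c * (\<Sum>w\<leftarrow>ws. norm w)"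
      also have "\<dots> \<le> c * (6 * k * d x y)"
        using le c by (intro mult_left_mono) auto
      finally have xz: "d x z \<le> m * d x y" by (simp add: m_def algebra_simps)
      also have "\<dots> \<le> m * 2" using dxy m by (intro mult_left_mono) auto
      finally have "d p z < R"
        using d_triangle [of p z x] pxy by (simp add: R_def m_def)
      moreover have "d p x < R"
        using pxy m by (simp add: R_def m_def)
      ultimately have "norm (gradh F z - gradh F x) \<le> C0 * d z x powr \<alpha>"
        by (intro C0) (auto simp: hball_def)
      also have "\<dots> \<le> C1 * (m * d x y) powr \<alpha>"
        using xz \<alpha> d_sym [of x z] by (intro mult_mono powr_mono2) (auto simp: C1_def)
      finally show "norm (gradh F z - gradh F x) \<le> ?B" .
    qed
    also have "?B * (\<Sum>w\<leftarrow>ws. norm w) \<le> ?B * (6 * k * d x y)"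
      using le by (intro mult_left_mono) (auto simp: C1_def)
    also have "\<dots> = C * (d x y powr \<alpha> * d x y)"
      using m by (simp add: C_def powr_mult)
    also have "d x y powr \<alpha> * d x y = d x y powr (1 + \<alpha>)"
      by (cases "d x y = 0") (auto simp: powr_add less_le)
    finally show ?thesis
      using ws(2) by simp
  qed
  moreover have "C > 0"
    using c k m by (simp add: C_def C1_def)
  ultimately show ?thesis by blast
qed

text \<open>The map \<open>f\<close> is \<open>F\<close> normalized to have the identity as
  horizontal gradient at \<open>p\<close>. Near \<open>p\<close> it is thus a small perturbation of
  the horizontal projection. On a level set this makes the vertical part dominate the gauge, and
  Taylor's formula then improves the bound on the horizontal part to the exponent (1 +
  \<alpha>)/2.\<close>

lemma level_set_estimates:
  assumes F: "C1alpha_h d \<alpha> F" and \<alpha>: "0 < \<alpha>" and nd: "nondegenerate F p"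
  defines "f \<equiv> \<lambda>x. matrix_inv (gradh F p) *v F x"
  shows "\<exists>r>0. \<exists>C\<ge>0. \<forall>x\<in>hball d p r. \<forall>y\<in>hball d p r.
     norm (f y - f x - hhor (hmul (hinv x) y)) \<le> gauge_h (hmul (hinv x) y) / 4 \<and>
     (f x = f y \<longrightarrow> norm (hhor (hmul (hinv x) y)) \<le> C * \<bar>hver (hmul (hinv x) y)\<bar> powr ((1 + \<alpha>) / 2))"
proof -
  let ?M = "gradh F p"
  obtain C1 where C1: "C1 > 0" "\<And>x y. x \<in> hball d p 1 \<Longrightarrow> y \<in> hball d p 1 \<Longrightarrow>
     norm (F y - F x - gradh F x *v hhor (hmul (hinv x) y)) \<le> C1 * d x y powr (1 + \<alpha>)"
    using taylor [OF F \<alpha>] by blast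
  obtain k where k: "k > 0" "\<And>x y. d x y \<le> k * gauge_h (hmul (hinv x) y)"
    using d_le_gauge_h by blast
  have "hbounded d (hball d p 1)"
    unfolding hbounded_def by blast
  then obtain C0 where C0:
    "\<And>x y. x \<in> hball d p 1 \<Longrightarrow> y \<in> hball d p 1 \<Longrightarrow>
       norm (gradh F x - gradh F y) \<le> C0 * d x y powr \<alpha>"
    using F unfolding C1alpha_h_def by meson
  define N where "N = norm (matrix_inv ?M)"
  \<comment> \<open>\<open>L\<close> collects the constants of both estimates, so that the single
    condition \<open>L * r powr \<alpha> \<le> 1 / 4\<close> on the radius suffices.\<close>
  define L where "L = (N + 1) * (C1 * 2 powr \<alpha> * (k + 1) + \<bar>C0\<bar> + 1)"
  have N: "N \<ge> 0" by (simp add: N_def)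
  have L: "L > 0"
    using N C1 k unfolding L_def by (intro mult_pos_pos add_nonneg_pos) auto
  define r where "r = min 1 ((1 / (4 * L)) powr (1 / \<alpha>))"
  have r: "r > 0" "r \<le> 1" using L by (auto simp: r_def)
  have rL: "L * r powr \<alpha> \<le> 1 / 4"
  proof -
    have "r powr \<alpha> \<le> ((1 / (4 * L)) powr (1 / \<alpha>)) powr \<alpha>"
      using r \<alpha> by (intro powr_mono2) (auto simp: r_def)
    also have "\<dots> = 1 / (4 * L)"
      using \<alpha> L by (simp add: powr_powr)
    finally show ?thesis using L by (simp add: field_simps)
  qed
  define C where "C = N * C1 * k powr (1 + \<alpha>) * 2 * 2 powr (1 + \<alpha>)"
  have "C \<ge> 0" using N C1 by (simp add: C_def)
  moreover have "norm (f y - f x - hhor (hmul (hinv x) y)) \<le> gauge_h (hmul (hinv x) y) / 4 \<and>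
     (f x = f y \<longrightarrow> norm (hhor (hmul (hinv x) y)) \<le> C * \<bar>hver (hmul (hinv x) y)\<bar> powr ((1 + \<alpha>) / 2))"
    if "x \<in> hball d p r" "y \<in> hball d p r" for x y
  proof -
    have pxy: "d p x < r" "d p y < r" using that by (auto simp: hball_def)
    have b1: "x \<in> hball d p 1" "y \<in> hball d p 1" "p \<in> hball d p 1"
      using pxy r by (auto simp: hball_def)
    have dxy: "d x y \<le> 2 * r"
      using d_triangle [of x y p] d_sym [of x p] pxy by simp
    let ?z = "hmul (hinv x) y"
    let ?h = "hhor ?z"
    have inv: "matrix_inv ?M *v (?M *v v) = v" for v
      using nd matrix_inv_mult(1) [of ?M]
      by (simp add: nondegenerate_def matrix_vector_mul_assoc)
    have eq: "f y - f x - ?h = matrix_inv ?M *v ((F y - F x - gradh F x *v ?h) + (gradh F x - ?M) *v ?h)"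
    proof -
      have "(F y - F x - gradh F x *v ?h) + (gradh F x - ?M) *v ?h = F y - F x - ?M *v ?h"
        by (simp add: matrix_vector_mult_diff_rdistrib)
      then show ?thesis
        by (simp only: f_def matrix_vector_mult_diff_distrib inv)
    qed
    have grad: "norm ((gradh F x - ?M) *v ?h) \<le> \<bar>C0\<bar> * r powr \<alpha> * norm ?h"
    proof -
      have "norm (gradh F x - ?M) \<le> C0 * d x p powr \<alpha>"
        using b1 by (intro C0)
      also have "\<dots> \<le> \<bar>C0\<bar> * r powr \<alpha>"
        using \<alpha> pxy d_sym [of x p] by (intro mult_mono powr_mono2) auto
      finally have "norm (gradh F x - ?M) * norm ?h \<le> \<bar>C0\<bar> * r powr \<alpha> * norm ?h"
        by (rule mult_right_mono) simp
      then show ?thesis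
        using norm_matrix_vector_mult_le order_trans by blast
    qed
    have tay: "norm (F y - F x - gradh F x *v ?h) \<le> C1 * d x y powr (1 + \<alpha>)"
      using b1 by (intro C1(2))
    have main: "norm (f y - f x - ?h) \<le> N * (C1 * d x y powr (1 + \<alpha>) + \<bar>C0\<bar> * r powr \<alpha> * norm ?h)"
      unfolding eq
      by (rule order_trans [OF norm_matrix_vector_mult_le])
        (unfold N_def, intro mult_left_mono norm_triangle_mono tay grad norm_ge_zero)
    have lin: "norm (f y - f x - ?h) \<le> gauge_h ?z / 4"
    proof -
      have "d x y powr (1 + \<alpha>) = d x y powr \<alpha> * d x y"
        by (cases "d x y = 0") (auto simp: powr_add less_le)
      also have "\<dots> \<le> (2 * r) powr \<alpha> * ((k + 1) * gauge_h ?z)"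
        using \<alpha> dxy order_trans [OF k(2) [of x y], of "(k + 1) * gauge_h ?z"]
        by (intro mult_mono powr_mono2) (auto simp: algebra_simps)
      finally have "d x y powr (1 + \<alpha>) \<le> 2 powr \<alpha> * r powr \<alpha> * ((k + 1) * gauge_h ?z)"
        using r by (simp add: powr_mult)
      then have "norm (f y - f x - ?h) \<le> (N + 1) * (C1 * (2 powr \<alpha> * r powr \<alpha> * ((k + 1) * gauge_h ?z))
          + (\<bar>C0\<bar> + 1) * r powr \<alpha> * gauge_h ?z)"
        using N C1(1) norm_hhor_le_gauge_h [of ?z]
        by (intro order_trans [OF main] mult_mono add_mono mult_left_mono) auto
      also have "\<dots> = (L * r powr \<alpha>) * gauge_h ?z"
        by (simp add: L_def algebra_simps)
      also have "\<dots> \<le> (1 / 4) * gauge_h ?z"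
        using rL by (intro mult_right_mono) auto
      finally show ?thesis by simp
    qed
    moreover have "norm ?h \<le> C * \<bar>hver ?z\<bar> powr ((1 + \<alpha>) / 2)" if fe: "f x = f y"
    proof -
      let ?v = "\<bar>hver ?z\<bar>"
      \<comment> \<open>With \<open>f x = f y\<close> the first estimate bounds the horizontal norm
        by a quarter of itself plus a quarter of the square root of the vertical part.\<close>
      have "3 * norm ?h \<le> sqrt ?v"
        using lin fe by (simp add: gauge_h_def)
      then have "norm ?h \<le> sqrt ?v"
        using norm_ge_zero [of ?h] by linarith
      then have g: "gauge_h ?z \<le> 2 * sqrt ?v"
        by (simp add: gauge_h_def)
      \<comment> \<open>The error from replacing \<open>gradh F x\<close> by
        \<open>gradh F p\<close> is linear in the horizontal displacement and is absorbed into the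
        left-hand side, leaving only the Taylor term.\<close>
      have "N * (\<bar>C0\<bar> * r powr \<alpha> * norm ?h) \<le> (L * r powr \<alpha>) * norm ?h"
      proof -
        have "N * \<bar>C0\<bar> \<le> L"
          using N C1(1) k(1) unfolding L_def by (intro mult_mono) auto
        then have "N * \<bar>C0\<bar> * (r powr \<alpha> * norm ?h) \<le> L * (r powr \<alpha> * norm ?h)"
          by (rule mult_right_mono) simp
        then show ?thesis by (simp add: algebra_simps)
      qed
      also have "\<dots> \<le> (1 / 4) * norm ?h"
        using rL by (intro mult_right_mono) auto
      finally have absorb: "N * (\<bar>C0\<bar> * r powr \<alpha> * norm ?h) \<le> (1 / 4) * norm ?h" .
      have "norm (f y - f x - ?h) = norm ?h"
        using fe by simp
      then have "norm ?h \<le> N * (C1 * d x y powr (1 + \<alpha>)) + N * (\<bar>C0\<bar> * r powr \<alpha> * norm ?h)"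
        using main by (simp only: distrib_left)
      then have h: "norm ?h \<le> 2 * (N * (C1 * d x y powr (1 + \<alpha>)))"
        using absorb norm_ge_zero [of ?h] by linarith
      have "d x y powr (1 + \<alpha>) \<le> (k * (2 * sqrt ?v)) powr (1 + \<alpha>)"
        using \<alpha> k g order_trans [OF k(2) [of x y] mult_left_mono [OF g]]
        by (intro powr_mono2) auto
      also have "(k * (2 * sqrt ?v)) powr (1 + \<alpha>) = k powr (1 + \<alpha>) * 2 powr (1 + \<alpha>) * ?v powr ((1 + \<alpha>) / 2)"
        using k by (simp add: powr_mult powr_powr flip: powr_half_sqrt)
      finally have "2 * (N * (C1 * d x y powr (1 + \<alpha>))) \<le>
          2 * (N * (C1 * (k powr (1 + \<alpha>) * 2 powr (1 + \<alpha>) * ?v powr ((1 + \<alpha>) / 2))))"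
        using N C1(1) by (intro mult_left_mono) auto
      then show ?thesis
        using h by (simp add: C_def algebra_simps)
    qed
    ultimately show ?thesis by blast
  qed
  ultimately show ?thesis
    using r(1) by blast
qed

end

section \<open>Discrete curves in a level set\<close>

text \<open>Since the exponent exceeds 1, a factor \<open>q powr \<alpha>\<close> is gained when
  neither summand exceeds the fraction \<open>q\<close> of the total. For \<open>q < 1\<close> this
  gain lets the induction in \<open>discrete_sewing\<close> close.\<close>

lemma powr_sum_le:
  fixes x y :: real
  assumes "0 \<le> x" "0 \<le> y" "x \<le> q * (x + y)" "y \<le> q * (x + y)" "0 \<le> \<alpha>" "0 \<le> q"
  shows "x powr (1 + \<alpha>) + y powr (1 + \<alpha>) \<le> q powr \<alpha> * (x + y) powr (1 + \<alpha>)"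
proof -
  have *: "z powr (1 + \<alpha>) = z powr \<alpha> * z" if "0 \<le> z" for z :: real
    using that by (cases "z = 0") (auto simp: powr_add)
  have "x powr (1 + \<alpha>) + y powr (1 + \<alpha>) = x powr \<alpha> * x + y powr \<alpha> * y"
    using assms by (simp add: *)
  also have "\<dots> \<le> (q * (x + y)) powr \<alpha> * x + (q * (x + y)) powr \<alpha> * y"
    using assms by (intro add_mono mult_right_mono powr_mono2) auto
  also have "\<dots> = q powr \<alpha> * (x + y) powr (1 + \<alpha>)"
    using assms by (simp only: * powr_mult add_nonneg_nonneg) (simp only: distrib_left mult.assoc)
  finally show ?thesis .
qed

text \<open>Induction on the length by bisection: the errors of the two halves together shrink by
  (2/3)^\<alpha>, and the defect at the midpoint adds at most \<open>4 * C\<close>. \<open>A\<close>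
  is the fixed point of this recursion and does not depend on the step \<open>u\<close>.\<close>

lemma discrete_sewing:
  fixes w :: "int \<Rightarrow> int \<Rightarrow> real" and \<alpha> u C :: real
  defines "A \<equiv> 4 * C / (1 - (2/3) powr \<alpha>)"
  assumes \<alpha>: "0 < \<alpha>" "\<alpha> \<le> 1" and u: "0 \<le> u" and C: "0 \<le> C"
    and refl: "\<And>i. w i i = 0"
    and step: "\<And>i. a \<le> i \<Longrightarrow> i < b \<Longrightarrow> w i (i + 1) = u"
    and add: "\<And>i k j. a \<le> i \<Longrightarrow> i \<le> k \<Longrightarrow> k \<le> j \<Longrightarrow> j \<le> b \<Longrightarrow>
       \<bar>w i j - w i k - w k j\<bar> \<le> C * (\<bar>w i k\<bar> * \<bar>w k j\<bar>) powr ((1 + \<alpha>) / 2)"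
    and small: "A * (of_int (b - a) * u) powr \<alpha> \<le> 1"
    and ij: "a \<le> i" "i \<le> j" "j \<le> b"
  shows "\<bar>w i j - of_int (j - i) * u\<bar> \<le> A * (of_int (j - i) * u) powr (1 + \<alpha>)"
  using ij
proof (induction "nat (j - i)" arbitrary: i j rule: less_induct)
  case less
  define \<kappa> where "\<kappa> = (2/3 :: real) powr \<alpha>"
  have "\<kappa> < (1::real) powr \<alpha>"
    unfolding \<kappa>_def using \<alpha> by (intro powr_less_mono2) auto
  then have \<kappa>: "\<kappa> < 1" by simp
  have A: "A \<ge> 0"
    using C \<kappa> by (simp add: A_def \<kappa>_def)
  have Asplit: "A * \<kappa> + 4 * C = A"
    using \<kappa> by (simp add: A_def \<kappa>_def [symmetric] field_simps)
  show ?case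
  proof (cases "j - i \<le> 1")
    case True
    then consider "j = i" | "j = i + 1" using less.prems by linarith
    then show ?thesis
      by cases (use refl step less.prems A in auto)
  next
    case False
    \<comment> \<open>Integer bisection: from length 2 on, neither half exceeds two thirds of the
      length, the worst case being 3 = 1 + 2.\<close>
    define k where "k = i + (j - i) div 2"
    have k: "i < k" "k < j"
      using False by (auto simp: k_def)
    have third: "3 * (k - i) \<le> 2 * (j - i)" "3 * (j - k) \<le> 2 * (j - i)"
      using False unfolding k_def by presburger+
    define x y where "x = of_int (k - i) * u" and "y = of_int (j - k) * u"
    have xy: "of_int (j - i) * u = x + y" "0 \<le> x" "0 \<le> y"
      using k u unfolding x_def y_def
      by (simp add: algebra_simps, (intro mult_nonneg_nonneg; simp)+)
    have "3 * x \<le> 2 * (x + y)" "3 * y \<le> 2 * (x + y)"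
    proof -
      have "real_of_int (3 * (k - i)) * u \<le> real_of_int (2 * (j - i)) * u"
        "real_of_int (3 * (j - k)) * u \<le> real_of_int (2 * (j - i)) * u"
        using third u by (intro mult_right_mono; simp only: of_int_le_iff)+
      then show "3 * x \<le> 2 * (x + y)" "3 * y \<le> 2 * (x + y)"
        by (simp_all add: x_def y_def algebra_simps)
    qed
    then have thirds: "x \<le> 2/3 * (x + y)" "y \<le> 2/3 * (x + y)"
      by simp_all
    have IH: "\<bar>w i k - x\<bar> \<le> A * x powr (1 + \<alpha>)" "\<bar>w k j - y\<bar> \<le> A * y powr (1 + \<alpha>)"
      unfolding x_def y_def using less.prems k by (intro less.hyps; simp)+
    \<comment> \<open>By smallness the error never exceeds the expected value, so the induction
      hypotheses bound \<open>w\<close> on each half by twice that value.\<close>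
    have bd: "A * z powr (1 + \<alpha>) \<le> z" if "0 \<le> z" "z \<le> x + y" for z
    proof -
      have "x + y \<le> of_int (b - a) * u"
        unfolding xy(1) [symmetric] using less.prems u by (intro mult_right_mono) auto
      then have "A * z powr \<alpha> \<le> A * (of_int (b - a) * u) powr \<alpha>"
        using that A \<alpha> by (intro mult_left_mono powr_mono2) auto
      then have "(A * z powr \<alpha>) * z \<le> 1 * z"
        using small that by (intro mult_right_mono) auto
      moreover have "z powr (1 + \<alpha>) = z powr \<alpha> * z"
        using that by (cases "z = 0") (auto simp: powr_add)
      ultimately show ?thesis by simp
    qed
    have "\<bar>w i k\<bar> \<le> 2 * (x + y)" "\<bar>w k j\<bar> \<le> 2 * (x + y)"
      using IH bd [OF xy(2)] bd [OF xy(3)] xy by simp_all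
    then have "\<bar>w i k\<bar> * \<bar>w k j\<bar> \<le> (2 * (x + y)) * (2 * (x + y))"
      using xy by (intro mult_mono) auto
    then have "(\<bar>w i k\<bar> * \<bar>w k j\<bar>) powr ((1 + \<alpha>) / 2) \<le> ((2 * (x + y))\<^sup>2) powr ((1 + \<alpha>) / 2)"
      using \<alpha> by (intro powr_mono2) (auto simp: power2_eq_square)
    also have "\<dots> = (2 * (x + y)) powr (1 + \<alpha>)"
      using xy by (cases "x + y = 0") (auto simp: powr_powr add_divide_distrib simp flip: powr_numeral)
    also have "\<dots> = 2 powr (1 + \<alpha>) * (x + y) powr (1 + \<alpha>)"
      by (rule powr_mult)
    \<comment> \<open>The exponent 1 + \<alpha> is at most 2; this is where the 4 in
      \<open>A\<close> comes from.\<close>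
    also have "\<dots> \<le> 4 * (x + y) powr (1 + \<alpha>)"
      using \<alpha> powr_mono [of "1 + \<alpha>" 2 2] by (intro mult_right_mono) auto
    finally have "C * (\<bar>w i k\<bar> * \<bar>w k j\<bar>) powr ((1 + \<alpha>) / 2) \<le> C * (4 * (x + y) powr (1 + \<alpha>))"
      using C by (rule mult_left_mono)
    moreover have "\<bar>w i j - w i k - w k j\<bar> \<le> C * (\<bar>w i k\<bar> * \<bar>w k j\<bar>) powr ((1 + \<alpha>) / 2)"
      using less.prems k by (intro add) auto
    ultimately have "\<bar>w i j - (x + y)\<bar> \<le> A * (x powr (1 + \<alpha>) + y powr (1 + \<alpha>)) + 4 * C * (x + y) powr (1 + \<alpha>)"
      using IH by (simp add: algebra_simps)
    also have "A * (x powr (1 + \<alpha>) + y powr (1 + \<alpha>)) \<le> A * (\<kappa> * (x + y) powr (1 + \<alpha>))"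
      unfolding \<kappa>_def using xy thirds \<alpha> A by (intro mult_left_mono powr_sum_le) auto
    also have "A * (\<kappa> * (x + y) powr (1 + \<alpha>)) + 4 * C * (x + y) powr (1 + \<alpha>)
        = (A * \<kappa> + 4 * C) * (x + y) powr (1 + \<alpha>)"
      by (simp add: algebra_simps)
    finally show ?thesis
      unfolding Asplit xy(1) by simp
  qed
qed

text \<open>Tychonoff's theorem. The index set may be uncountable, so convergence is along a filter
  finer than \<open>sequentially\<close> instead of a subsequence; limits of inequalities pass
  through it all the same.\<close>

lemma pointwise_cluster_point:
  fixes g :: "nat \<Rightarrow> 'b \<Rightarrow> 'a::topological_space"
  assumes S: "compact S" and g: "\<And>n t. g n t \<in> S"
  obtains H l where "H \<noteq> bot" "H \<le> sequentially" "\<And>t. l t \<in> S" "\<And>t. ((\<lambda>n. g n t) \<longlongrightarrow> l t) H"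
proof -
  have "compactin (product_topology (\<lambda>i::'b. euclidean) UNIV) (PiE UNIV (\<lambda>_. S))"
    using S by (simp add: compactin_PiE)
  then have "compact (PiE UNIV (\<lambda>_::'b. S))"
    by (simp add: euclidean_product_topology)
  moreover have "eventually (\<lambda>h. h \<in> PiE UNIV (\<lambda>_. S)) (filtermap g sequentially)"
    using g by (simp add: eventually_filtermap PiE_UNIV_domain)
  ultimately obtain l where l: "l \<in> PiE UNIV (\<lambda>_. S)" "inf (nhds l) (filtermap g sequentially) \<noteq> bot"
    unfolding compact_filter by (metis filtermap_bot_iff trivial_limit_sequentially)
  \<comment> \<open>The neighbourhoods of the cluster point pulled back to indices; being a cluster
    point is what makes \<open>H\<close> nontrivial.\<close>
  define H where "H = inf sequentially (filtercomap g (nhds l))"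
  have "H \<noteq> bot"
  proof
    assume "H = bot"
    then have "eventually (\<lambda>_. False) H" by simp
    then obtain P Q where PQ: "eventually P sequentially" "eventually Q (filtercomap g (nhds l))"
      "\<And>n. P n \<and> Q n \<Longrightarrow> False"
      unfolding H_def eventually_inf by blast
    then obtain R where R: "eventually R (nhds l)" "\<And>n. R (g n) \<Longrightarrow> Q n"
      unfolding eventually_filtercomap by blast
    have "eventually (\<lambda>h. \<not> R h) (filtermap g sequentially)"
      unfolding eventually_filtermap using PQ(1) by (rule eventually_mono) (use PQ(3) R(2) in blast)
    with R(1) have "eventually (\<lambda>_. False) (inf (nhds l) (filtermap g sequentially))"
      unfolding eventually_inf by blast
    with l(2) show False by (simp add: trivial_limit_def)
  qed
  moreover have "H \<le> sequentially" by (simp add: H_def)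
  moreover have "l t \<in> S" for t using l(1) by auto
  moreover have "((\<lambda>n. g n t) \<longlongrightarrow> l t) H" for t
  proof -
    have "(g \<longlongrightarrow> l) H"
      unfolding H_def filterlim_iff_le_filtercomap by simp
    then show ?thesis
      by (rule continuous_on_tendsto_compose [OF continuous_on_product_coordinates]) auto
  qed
  ultimately show thesis by (rule that)
qed

text \<open>Retains from \<open>F\<close> only the two estimates of
  \<open>level_set_estimates\<close>, on which the construction of the curve rests.\<close>

locale hor_chart = homog +
  fixes f :: "heis \<Rightarrow> real^2" and p :: heis and r C \<alpha> :: real
  assumes r: "0 < r" and C: "0 \<le> C" and \<alpha>: "0 < \<alpha>" "\<alpha> \<le> 1"
    and lin: "x \<in> hball d p r \<Longrightarrow> y \<in> hball d p r \<Longrightarrow>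
       norm (f y - f x - hhor (hmul (hinv x) y)) \<le> gauge_h (hmul (hinv x) y) / 4"
    and level: "x \<in> hball d p r \<Longrightarrow> y \<in> hball d p r \<Longrightarrow> f x = f y \<Longrightarrow>
       norm (hhor (hmul (hinv x) y)) \<le> C * \<bar>hver (hmul (hinv x) y)\<bar> powr ((1 + \<alpha>) / 2)"
begin

abbreviation \<omega> :: "heis \<Rightarrow> heis \<Rightarrow> real" where
  "\<omega> x y \<equiv> hver (hmul (hinv x) y)"

section \<open>Level sets inside the chart ball\<close>

lemma level_gauge:
  assumes "x \<in> hball d p r" "y \<in> hball d p r" "f x = f y"
  shows "gauge_h (hmul (hinv x) y) \<le> 2 * sqrt \<bar>\<omega> x y\<bar>"
proof -
  let ?h = "hhor (hmul (hinv x) y)"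
  have "3 * norm ?h \<le> sqrt \<bar>\<omega> x y\<bar>"
    using lin [OF assms(1,2)] assms(3) by (simp add: gauge_h_def)
  then show ?thesis
    using norm_ge_zero [of ?h] unfolding gauge_h_def by linarith
qed

lemma level_eq:
  assumes "x \<in> hball d p r" "y \<in> hball d p r" "f x = f y" "\<omega> x y = 0"
  shows "x = y"
  using level [OF assms(1-3)] assms(4) by (intro heis_eqI) auto

text \<open>The defect is an area of two horizontal displacements, each of order (1 + \<alpha>)/2 in
  \<open>\<omega>\<close>; the total order 1 + \<alpha> > 1 is what sewing requires.\<close>

lemma level_almost_additive:
  assumes "x \<in> hball d p r" "y \<in> hball d p r" "z \<in> hball d p r" "f x = f y" "f y = f z"
  shows "\<bar>\<omega> x z - \<omega> x y - \<omega> y z\<bar> \<le> C\<^sup>2 * (\<bar>\<omega> x y\<bar> * \<bar>\<omega> y z\<bar>) powr ((1 + \<alpha>) / 2)"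
proof -
  have "\<bar>\<omega> x z - \<omega> x y - \<omega> y z\<bar> \<le> norm (hhor (hmul (hinv x) y)) * norm (hhor (hmul (hinv y) z))"
    by (simp add: hver_chasles [of x z y] abs_wedge_le)
  also have "\<dots> \<le> (C * \<bar>\<omega> x y\<bar> powr ((1 + \<alpha>) / 2)) * (C * \<bar>\<omega> y z\<bar> powr ((1 + \<alpha>) / 2))"
    using assms C by (intro mult_mono level) auto
  also have "\<dots> = C\<^sup>2 * (\<bar>\<omega> x y\<bar> * \<bar>\<omega> y z\<bar>) powr ((1 + \<alpha>) / 2)"
    by (simp add: powr_mult power2_eq_square algebra_simps)
  finally show ?thesis .
qed

lemma continuous_on_f: "continuous_on (hball d p r) f"
proof (rule continuous_on_lipschitz_gauge_h)
  fix x y assume xy: "x \<in> hball d p r" "y \<in> hball d p r"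
  have "norm (f y - f x) \<le> norm (f y - f x - hhor (hmul (hinv x) y)) + norm (hhor (hmul (hinv x) y))"
    using norm_triangle_ineq [of "f y - f x - hhor (hmul (hinv x) y)" "hhor (hmul (hinv x) y)"] by simp
  then show "dist (f y) (f x) \<le> 2 * gauge_h (hmul (hinv x) y)"
    using lin [OF xy] norm_hhor_le_gauge_h [of "hmul (hinv x) y"] gauge_h_nonneg [of "hmul (hinv x) y"]
    unfolding dist_norm by linarith
qed

text \<open>A zero of \<open>h \<mapsto> f (x (h, u)) - f x\<close> is a fixed point of a continuous self-map of
  the disc of radius \<open>\<surd>|u|\<close>; on vertical slices \<open>f\<close> is not Lipschitz, so contraction would not do.\<close>
lemma level_step:
  assumes k: "0 < k" "\<And>x y. d x y \<le> k * gauge_h (hmul (hinv x) y)"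
    and x: "x \<in> hball d p (r/2)" and u: "2 * k * sqrt \<bar>u\<bar> < r / 2"
  shows "\<exists>y\<in>hball d p r. f y = f x \<and> \<omega> x y = u"
proof -
  let ?D = "cball (0::real^2) (sqrt \<bar>u\<bar>)"
  define e where "e h = (h $ 1, h $ 2, u)" for h :: "real^2"
  have e: "hhor (e h) = h" "hver (e h) = u" for h
    by (rule vec2_eqI) (simp_all add: e_def hver_def hx3_def)
  have ge: "gauge_h (e h) \<le> 2 * sqrt \<bar>u\<bar>" if "h \<in> ?D" for h
    using that by (simp add: gauge_h_def e)
  have px: "d p x < r / 2" using x by (simp add: hball_def)
  have xB: "x \<in> hball d p r" using px r by (simp add: hball_def)
  have B: "hmul x (e h) \<in> hball d p r" if "h \<in> ?D" for h
  proof -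
    have "d x (hmul x (e h)) \<le> k * gauge_h (e h)"
      using k(2) [of x "hmul x (e h)"] by simp
    also have "\<dots> \<le> k * (2 * sqrt \<bar>u\<bar>)"
      using ge [OF that] k(1) by (intro mult_left_mono) auto
    finally have "d p (hmul x (e h)) < r"
      using d_triangle [of p "hmul x (e h)" x] px u by simp
    then show ?thesis by (simp add: hball_def)
  qed
  define \<Phi> where "\<Phi> h = h - (f (hmul x (e h)) - f x)" for h
  have "continuous_on ?D e"
    unfolding e_def by (intro continuous_intros)
  then have "continuous_on ?D (\<lambda>h. f (hmul x (e h)))"
    using B by (intro continuous_on_compose2 [OF continuous_on_f] continuous_intros) auto
  then have "continuous_on ?D \<Phi>"
    unfolding \<Phi>_def by (intro continuous_intros)
  moreover have "\<Phi> \<in> ?D \<rightarrow> ?D"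
  proof
    fix h assume h: "h \<in> ?D"
    \<comment> \<open>On the disc the gauge of \<open>e h\<close> is at most twice the radius, so
      \<open>lin\<close> keeps \<open>\<Phi> h\<close> within half the radius.\<close>
    have "norm (f (hmul x (e h)) - f x - h) \<le> gauge_h (e h) / 4"
      using lin [OF xB B [OF h]] by (simp add: e)
    moreover have "norm (\<Phi> h) = norm (f (hmul x (e h)) - f x - h)"
      unfolding \<Phi>_def by (rule norm_minus_commute)
    moreover have "0 \<le> sqrt \<bar>u\<bar>" by simp
    ultimately show "\<Phi> h \<in> ?D"
      using ge [OF h] unfolding mem_cball_0 by linarith
  qed
  ultimately obtain h where h: "h \<in> ?D" "\<Phi> h = h"
    using brouwer [of ?D \<Phi>] by auto
  then show ?thesis
    using B e by (intro bexI [of _ "hmul x (e h)"]) (auto simp: \<Phi>_def)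
qed

text \<open>The constant \<open>A\<close> of \<open>discrete_sewing\<close> for the defect constant
  \<open>C\<^sup>2\<close> of \<open>level_almost_additive\<close>.\<close>

definition sew :: real where
  "sew = 4 * C\<^sup>2 / (1 - (2/3) powr \<alpha>)"

lemma sew_nonneg: "0 \<le> sew"
proof -
  have "(2/3 :: real) powr \<alpha> < 1 powr \<alpha>"
    using \<alpha> by (intro powr_less_mono2) auto
  then show ?thesis by (simp add: sew_def)
qed

lemma chain_estimate:
  fixes c :: "int \<Rightarrow> heis"
  assumes "0 \<le> u"
    and c: "\<And>i. a \<le> i \<Longrightarrow> i \<le> b \<Longrightarrow> c i \<in> hball d p r \<and> f (c i) = z"
    and step: "\<And>i. a \<le> i \<Longrightarrow> i < b \<Longrightarrow> \<omega> (c i) (c (i + 1)) = u"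
    and small: "sew * (of_int (b - a) * u) powr \<alpha> \<le> 1"
    and ij: "a \<le> i" "i \<le> j" "j \<le> b"
  shows "\<bar>\<omega> (c i) (c j) - of_int (j - i) * u\<bar> \<le> sew * (of_int (j - i) * u) powr (1 + \<alpha>)"
  unfolding sew_def
proof (rule discrete_sewing [where a=a and b=b])
  fix i k j assume "a \<le> i" "i \<le> k" "k \<le> j" "j \<le> b"
  then show "\<bar>\<omega> (c i) (c j) - \<omega> (c i) (c k) - \<omega> (c k) (c j)\<bar>
      \<le> C\<^sup>2 * (\<bar>\<omega> (c i) (c k)\<bar> * \<bar>\<omega> (c k) (c j)\<bar>) powr ((1 + \<alpha>) / 2)"
    by (intro level_almost_additive) (auto simp: c)
qed (use assms \<alpha> in \<open>auto simp: sew_def\<close>)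

text \<open>Turns the sewing error into a fraction of the elapsed parameter on short intervals; used
  with \<open>B\<close> equal to 1 and to 1/2.\<close>

lemma powr_one_plus_le:
  assumes "0 \<le> z" "z \<le> D" "sew * D powr \<alpha> \<le> B"
  shows "sew * z powr (1 + \<alpha>) \<le> B * z"
proof -
  have "sew * z powr \<alpha> \<le> sew * D powr \<alpha>"
    using assms \<alpha> sew_nonneg by (intro mult_left_mono powr_mono2) auto
  then have "(sew * z powr \<alpha>) * z \<le> B * z"
    using assms by (intro mult_right_mono) auto
  moreover have "z powr (1 + \<alpha>) = z powr \<alpha> * z"
    using assms by (cases "z = 0") (auto simp: powr_add)
  ultimately show ?thesis by simp
qed

text \<open>One step is added at each end. Adding up the distances of single steps, each of order
  \<open>sqrt u\<close>, would not keep the chain in a fixed ball. Instead the new ends are known to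
  lie in the ball of radius \<open>r\<close>, where \<open>chain_estimate\<close> bounds their
  displacement from \<open>q\<close> directly and brings them back within \<open>r/2\<close>, so
  that \<open>level_step\<close> applies again.\<close>

lemma chain_exists:
  assumes k: "0 < k" "\<And>x y. d x y \<le> k * gauge_h (hmul (hinv x) y)"
    and \<delta>: "sew * (2 * \<delta>) powr \<alpha> \<le> 1" "8 * k * sqrt (2 * \<delta>) \<le> r"
    and q: "q \<in> hball d p (r/4)" and u: "0 \<le> u"
  shows "real m * u \<le> \<delta> \<Longrightarrow> \<exists>c. c 0 = q \<and>
     (\<forall>i\<in>{- int m..int m}. c i \<in> hball d p (r/2) \<and> f (c i) = f q) \<and>
     (\<forall>i\<in>{- int m..<int m}. \<omega> (c i) (c (i + 1)) = u)"
proof (induction m)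
  case 0
  then show ?case
    using q r by (intro exI [of _ "\<lambda>_. q"]) (auto simp: hball_def)
next
  case (Suc m)
  have u\<delta>: "u \<le> \<delta>" "real m * u \<le> \<delta>"
    using Suc.prems u by (simp_all add: algebra_simps) (smt (verit) mult_nonneg_nonneg of_nat_0_le_iff)+
  then obtain c where c: "c 0 = q"
    "\<And>i. i \<in> {- int m..int m} \<Longrightarrow> c i \<in> hball d p (r/2) \<and> f (c i) = f q"
    "\<And>i. i \<in> {- int m..<int m} \<Longrightarrow> \<omega> (c i) (c (i + 1)) = u"
    using Suc.IH by blast
  have "sqrt u \<le> sqrt (2 * \<delta>)"
    using u u\<delta> by simp
  then have "2 * k * sqrt u \<le> 2 * k * sqrt (2 * \<delta>)"
    using k(1) by (intro mult_left_mono) auto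
  then have "2 * k * sqrt u < r / 2"
    using \<delta>(2) r by linarith
  then have us: "2 * k * sqrt \<bar>u\<bar> < r / 2" "2 * k * sqrt \<bar>- u\<bar> < r / 2"
    using u by simp_all
  obtain y where y: "y \<in> hball d p r" "f y = f (c (int m))" "\<omega> (c (int m)) y = u"
    using level_step [OF k _ us(1), of "c (int m)"] c(2) [of "int m"] by auto
  \<comment> \<open>Backwards, a step of height \<open>- u\<close> is taken; antisymmetry of
    \<open>\<omega>\<close> turns it into a step of height \<open>u\<close> from the new
    point.\<close>
  obtain y' where y': "y' \<in> hball d p r" "f y' = f (c (- int m))" "\<omega> (c (- int m)) y' = - u"
    using level_step [OF k _ us(2), of "c (- int m)"] c(2) [of "- int m"] by auto
  define M where "M = int m + 1"
  define c' where "c' = c(M := y, - M := y')"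
  have M: "M > 0" by (simp add: M_def)
  have c'_in: "c' i = c i" if "i \<in> {- int m..int m}" for i
    using that by (auto simp: c'_def M_def)
  have c'_M: "c' M = y" "c' (- M) = y'"
    using M by (simp_all add: c'_def)
  have range: "i \<in> {- int m..int m} \<or> i = M \<or> i = - M" if "- M \<le> i" "i \<le> M" for i
    using that by (auto simp: M_def)
  have "hball d p (r/2) \<subseteq> hball d p r"
    using r by (auto simp: hball_def)
  then have c'r: "c' i \<in> hball d p r \<and> f (c' i) = f q" if "- M \<le> i" "i \<le> M" for i
    using range [OF that] c(2) c(2) [of "int m"] c(2) [of "- int m"] y y' c'_in c'_M
    by (auto simp del: atLeastAtMost_iff) auto
  have c'u: "\<omega> (c' i) (c' (i + 1)) = u" if "- M \<le> i" "i < M" for i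
  proof -
    have "i \<in> {- int m..<int m} \<or> i = int m \<or> i = - M"
      using that by (auto simp: M_def)
    then consider "i \<in> {- int m..<int m}" | "i = int m" | "i = - M"
      by blast
    then show ?thesis
    proof cases
      case 1
      then show ?thesis using c(3) [of i] c'_in [of i] c'_in [of "i + 1"] by auto
    next
      case 2
      then show ?thesis using y(3) c'_in [of i] c'_M by (simp add: M_def)
    next
      case 3
      then have "c' i = y'" "c' (i + 1) = c (- int m)"
        using c'_in [of "- int m"] c'_M by (auto simp: M_def)
      then show ?thesis
        using y'(3) hver_swap [of "c (- int m)" y'] by simp
    qed
  qed
  have Mu: "of_int M * u \<le> \<delta>"
    using Suc.prems by (simp add: M_def algebra_simps)
  have "sew * (of_int (M - - M) * u) powr \<alpha> \<le> sew * (2 * \<delta>) powr \<alpha>"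
    using Mu u M \<alpha> sew_nonneg by (intro mult_left_mono powr_mono2) auto
  then have small: "sew * (of_int (M - - M) * u) powr \<alpha> \<le> 1"
    using \<delta>(1) by linarith
  \<comment> \<open>Only pairs at most \<open>M\<close> steps apart matter, since one of the two
    points will be \<open>q\<close>, at index 0.\<close>
  have est: "\<bar>\<omega> (c' i) (c' j)\<bar> \<le> 2 * \<delta>" if "- M \<le> i" "i \<le> j" "j \<le> M" "j - i \<le> M" for i j
  proof -
    have "\<bar>\<omega> (c' i) (c' j) - of_int (j - i) * u\<bar> \<le> sew * (of_int (j - i) * u) powr (1 + \<alpha>)"
      by (rule chain_estimate [where c = c' and z = "f q" and a = "-M" and b = M, OF u c'r c'u small]) (use that in auto)
    also have "\<dots> \<le> 1 * (of_int (j - i) * u)"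
    proof (rule powr_one_plus_le [OF _ _ small])
      show "real_of_int (j - i) * u \<le> real_of_int (M - - M) * u"
        using that u M by (intro mult_right_mono) auto
    qed (use that u in auto)
    finally have "\<bar>\<omega> (c' i) (c' j)\<bar> \<le> 2 * (of_int (j - i) * u)"
      by linarith
    also have "of_int (j - i) * u \<le> of_int M * u"
      using that u by (intro mult_right_mono) auto
    finally show ?thesis using Mu by simp
  qed
  have c'0: "c' 0 = q"
    using c(1) c'_in [of 0] by simp
  have "c' i \<in> hball d p (r/2)" if "- M \<le> i" "i \<le> M" for i
  proof -
    have "\<bar>\<omega> q (c' i)\<bar> \<le> 2 * \<delta>"
      using est [of 0 i] est [of i 0] that M c'0 hver_swap [of q "c' i"] by (cases "0 \<le> i") auto
    then have "sqrt \<bar>\<omega> q (c' i)\<bar> \<le> sqrt (2 * \<delta>)"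
      by (rule real_sqrt_le_mono)
    moreover have "q \<in> hball d p r"
      using q r by (auto simp: hball_def)
    then have "gauge_h (hmul (hinv q) (c' i)) \<le> 2 * sqrt \<bar>\<omega> q (c' i)\<bar>"
      using c'r [OF that] by (intro level_gauge) auto
    ultimately have "gauge_h (hmul (hinv q) (c' i)) \<le> 2 * sqrt (2 * \<delta>)"
      by linarith
    then have "k * gauge_h (hmul (hinv q) (c' i)) \<le> k * (2 * sqrt (2 * \<delta>))"
      using k(1) by (intro mult_left_mono) auto
    then have "d q (c' i) \<le> r / 4"
      using k(2) [of q "c' i"] \<delta>(2) by linarith
    then show ?thesis
      using q d_triangle [of p "c' i" q] by (simp add: hball_def)
  qed
  moreover have "int (Suc m) = M" by (simp add: M_def)
  ultimately show ?case
    using c'0 c'r c'u by (intro exI [of _ c']) auto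
qed

text \<open>Chains with steps tending to 0, read as step functions of time, have a pointwise cluster
  point. The sewing bound holds for all of them with the same constant, so it survives in the
  limit.\<close>

lemma level_curve_exists:
  assumes k: "0 < k" "\<And>x y. d x y \<le> k * gauge_h (hmul (hinv x) y)"
    and \<delta>: "0 < \<delta>" "sew * (2 * \<delta>) powr \<alpha> \<le> 1" "8 * k * sqrt (2 * \<delta>) \<le> r"
    and q: "q \<in> hball d p (r/4)"
  shows "\<exists>\<gamma>. \<gamma> 0 = q \<and> (\<forall>t. \<gamma> t \<in> hball d p r \<and> f (\<gamma> t) = f q) \<and>
    (\<forall>s\<in>{-\<delta>..\<delta>}. \<forall>t\<in>{-\<delta>..\<delta>}. \<bar>\<omega> (\<gamma> s) (\<gamma> t) - (t - s)\<bar> \<le> sew * \<bar>t - s\<bar> powr (1 + \<alpha>))"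
proof -
  define u where "u n = \<delta> / real (Suc n)" for n
  have u: "u n > 0" "real (Suc n) * u n = \<delta>" for n
    using \<delta>(1) by (simp_all add: u_def field_simps)
  have "\<forall>n. \<exists>c. c 0 = q \<and>
     (\<forall>i\<in>{- int (Suc n)..int (Suc n)}. c i \<in> hball d p (r/2) \<and> f (c i) = f q) \<and>
     (\<forall>i\<in>{- int (Suc n)..<int (Suc n)}. \<omega> (c i) (c (i + 1)) = u n)"
    using u by (intro allI chain_exists [OF k \<delta>(2,3) q]) (auto simp: less_imp_le)
  then obtain c where c: "\<And>n. c n 0 = q"
    "\<And>n i. i \<in> {- int (Suc n)..int (Suc n)} \<Longrightarrow> c n i \<in> hball d p (r/2) \<and> f (c n i) = f q"
    "\<And>n i. i \<in> {- int (Suc n)..<int (Suc n)} \<Longrightarrow> \<omega> (c n i) (c n (i + 1)) = u n"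
    by metis
  define N where "N n t = \<lfloor>t / u n\<rfloor>" for n t
  \<comment> \<open>The value \<open>q\<close> outside the interval keeps \<open>g\<close> in the
    compact set at every time.\<close>
  define g where "g n t = (if t \<in> {-\<delta>..\<delta>} then c n (N n t) else q)" for n t
  have N: "N n t \<in> {- int (Suc n)..int (Suc n)}" if "t \<in> {-\<delta>..\<delta>}" for n t
  proof -
    have "- real (Suc n) * u n \<le> t" "t \<le> real (Suc n) * u n"
      using that unfolding mult_minus_left u(2) by auto
    then have "- real (Suc n) \<le> t / u n" "t / u n \<le> real (Suc n)"
      using u(1) [of n] by (simp_all only: pos_le_divide_eq pos_divide_le_eq)
    then show ?thesis
      unfolding N_def by (auto simp: le_floor_iff floor_le_iff)
  qed
  have qr: "q \<in> hball d p (r/2)"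
    using q r by (auto simp: hball_def)
  have g: "g n t \<in> hball d p (r/2)" "f (g n t) = f q" for n t
    using c(2) [OF N] qr by (auto simp: g_def)
  \<comment> \<open>The closed ball of radius \<open>r/2\<close> is still inside the open ball of
    radius \<open>r\<close>, so limits remain where the chart estimates hold.\<close>
  have compact: "compact {x. d p x \<le> r/2}"
  proof -
    obtain k' where k': "k' > 0" "\<And>x y. gauge_h (hmul (hinv x) y) \<le> k' * d x y"
      using gauge_h_le_d by blast
    have "{x. d p x \<le> r/2} \<subseteq> hmul p ` {x. gauge_h x \<le> k' * (r/2)}"
    proof
      fix x assume "x \<in> {x. d p x \<le> r/2}"
      then have "gauge_h (hmul (hinv p) x) \<le> k' * (r/2)"
        using k'(1) by (intro order_trans [OF k'(2)] mult_left_mono) auto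
      then show "x \<in> hmul p ` {x. gauge_h x \<le> k' * (r/2)}"
        by (intro image_eqI [of _ _ "hmul (hinv p) x"]) auto
    qed
    moreover have "compact (hmul p ` {x. gauge_h x \<le> k' * (r/2)})"
      by (intro compact_continuous_image compact_gauge_h_ball continuous_intros)
    moreover have "closed {x. d p x \<le> r/2}"
      by (intro closed_Collect_le continuous_on_d continuous_intros)
    ultimately show ?thesis
      by (metis compact_Int_closed inf.absorb_iff2)
  qed
  obtain H \<gamma> where H: "H \<noteq> bot" "H \<le> sequentially"
    and \<gamma>: "\<And>t. \<gamma> t \<in> {x. d p x \<le> r/2}" and lim: "\<And>t. ((\<lambda>n. g n t) \<longlongrightarrow> \<gamma> t) H"
    using pointwise_cluster_point [OF compact, of g] g by (auto simp: hball_def less_imp_le)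
  have \<gamma>r: "\<gamma> t \<in> hball d p r" for t
    using \<gamma> [of t] r by (simp add: hball_def)
  have "f (\<gamma> t) = f q" for t
  proof -
    have "((\<lambda>n. f (g n t)) \<longlongrightarrow> f (\<gamma> t)) H"
    proof (rule continuous_on_tendsto_compose [OF continuous_on_f lim \<gamma>r])
      show "\<forall>\<^sub>F n in H. g n t \<in> hball d p r"
        using g(1) [of _ t] r by (intro always_eventually allI) (smt (verit) hball_def mem_Collect_eq field_sum_of_halves)
    qed
    then show ?thesis
      using H(1) by (simp add: g(2) tendsto_const_iff)
  qed
  moreover have "\<gamma> 0 = q"
  proof -
    have "g n 0 = q" for n
      using \<delta>(1) c(1) by (simp add: g_def N_def)
    then show ?thesis
      using lim [of 0] H(1) by (simp add: tendsto_const_iff)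
  qed
  moreover have "\<bar>\<omega> (\<gamma> s) (\<gamma> t) - (t - s)\<bar> \<le> sew * \<bar>t - s\<bar> powr (1 + \<alpha>)"
    if st: "s \<in> {-\<delta>..\<delta>}" "t \<in> {-\<delta>..\<delta>}" and le: "s \<le> t" for s t
  proof -
    \<comment> \<open>The time elapsed on the grid, which tends to \<open>t - s\<close>.\<close>
    define \<phi> where "\<phi> n = of_int (N n t - N n s) * u n" for n
    have \<phi>0: "0 \<le> \<phi> n" for n
      using le u(1) [of n] unfolding \<phi>_def N_def
      by (intro mult_nonneg_nonneg) (auto intro!: floor_mono divide_right_mono)
    have est: "\<bar>\<omega> (g n s) (g n t) - \<phi> n\<bar> \<le> sew * \<phi> n powr (1 + \<alpha>)" for n
    proof -
      have "\<bar>\<omega> (c n (N n s)) (c n (N n t)) - of_int (N n t - N n s) * u n\<bar>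
          \<le> sew * (of_int (N n t - N n s) * u n) powr (1 + \<alpha>)"
      proof (rule chain_estimate [where a = "- int (Suc n)" and b = "int (Suc n)"])
        have "real_of_int (int (Suc n) - - int (Suc n)) * u n = 2 * \<delta>"
          using u(2) [of n] by (simp add: algebra_simps)
        then show "sew * (real_of_int (int (Suc n) - - int (Suc n)) * u n) powr \<alpha> \<le> 1"
          using \<delta>(2) by simp
        show "N n s \<le> N n t"
          using le u(1) [of n] unfolding N_def by (intro floor_mono divide_right_mono) auto
        show "c n i \<in> hball d p r \<and> f (c n i) = f q" if "- int (Suc n) \<le> i" "i \<le> int (Suc n)" for i
          using c(2) [of i n] that r by (auto simp: hball_def)
      qed (use N [OF st(1), of n] N [OF st(2), of n] c(3) u(1) [of n] in auto)
      then show ?thesis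
        using st by (simp add: g_def \<phi>_def)
    qed
    have "(u \<longlongrightarrow> 0) H"
      unfolding u_def by (rule tendsto_mono [OF H(2)]) (rule LIMSEQ_Suc, rule lim_const_over_n)
    have "((\<lambda>n. of_int (N n t) * u n) \<longlongrightarrow> t) H" for t
    proof -
      have "\<bar>of_int (N n t) * u n - t\<bar> \<le> u n" for n
      proof -
        have "of_int (N n t) \<le> t / u n" "t / u n \<le> of_int (N n t) + 1"
          unfolding N_def by linarith+
        then have "of_int (N n t) * u n \<le> t" "t \<le> (of_int (N n t) + 1) * u n"
          using u(1) [of n] by (simp_all only: pos_le_divide_eq pos_divide_le_eq)
        then show ?thesis by (simp add: algebra_simps)
      qed
      then have "((\<lambda>n. of_int (N n t) * u n - t) \<longlongrightarrow> 0) H"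
        by (intro Lim_null_comparison [OF always_eventually \<open>(u \<longlongrightarrow> 0) H\<close>]) simp
      then show ?thesis
        using Lim_null by blast
    qed
    from tendsto_diff [OF this [of t] this [of s]] have \<phi>: "(\<phi> \<longlongrightarrow> t - s) H"
      unfolding \<phi>_def by (simp add: algebra_simps)
    have "((\<lambda>n. \<omega> (g n s) (g n t)) \<longlongrightarrow> \<omega> (\<gamma> s) (\<gamma> t)) H"
      unfolding heis_simps hver_def by (intro tendsto_intros lim)
    then have "((\<lambda>n. \<bar>\<omega> (g n s) (g n t) - \<phi> n\<bar>) \<longlongrightarrow> \<bar>\<omega> (\<gamma> s) (\<gamma> t) - (t - s)\<bar>) H"
      by (intro tendsto_intros \<phi>)
    \<comment> \<open>The base may tend to 0, when \<open>s = t\<close>; nonnegative bases and a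
      positive exponent still give continuity of the power.\<close>
    moreover have "((\<lambda>n. sew * \<phi> n powr (1 + \<alpha>)) \<longlongrightarrow> sew * (t - s) powr (1 + \<alpha>)) H"
      using \<phi>0 \<alpha> by (intro tendsto_mult tendsto_const tendsto_powr2 \<phi> always_eventually) auto
    ultimately have "\<bar>\<omega> (\<gamma> s) (\<gamma> t) - (t - s)\<bar> \<le> sew * (t - s) powr (1 + \<alpha>)"
      using H(1) est by (intro tendsto_le [of H]) auto
    then show ?thesis
      using le by simp
  qed note forward = this
  moreover have "\<bar>\<omega> (\<gamma> s) (\<gamma> t) - (t - s)\<bar> \<le> sew * \<bar>t - s\<bar> powr (1 + \<alpha>)"
    if st: "s \<in> {-\<delta>..\<delta>}" "t \<in> {-\<delta>..\<delta>}" for s t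
  proof (cases "s \<le> t")
    case False
    then show ?thesis
      using forward [of t s] st hver_swap [of "\<gamma> s" "\<gamma> t"] by (simp add: abs_minus_commute algebra_simps)
  qed (use forward st in auto)
  ultimately show ?thesis
    using \<gamma>r by blast
qed

end

section \<open>Level curves\<close>

text \<open>The values of \<open>F\<close> cancel in the difference of remainders, leaving only
  linear terms at \<open>p\<close>, which the inverse gradient undoes.\<close>

lemma hhor_eq_Rem:
  assumes "invertible (gradh F p)" "F x = F y"
  shows "hhor (hmul (hinv x) y) = - (matrix_inv (gradh F p) *v (Rem F p y - Rem F p x))"
proof -
  let ?M = "gradh F p"
  have "Rem F p y - Rem F p x = ?M *v hhor x - ?M *v hhor y"
    by (simp add: Rem_def assms(2) hhor_diff matrix_vector_mult_diff_distrib)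
  then have "matrix_inv ?M *v (Rem F p y - Rem F p x) = (matrix_inv ?M ** ?M) *v (hhor x - hhor y)"
    by (simp only: matrix_vector_mul_assoc [symmetric] matrix_vector_mult_diff_distrib)
  then show ?thesis
    by (simp add: matrix_inv_mult(1) [OF assms(1)] hhor_diff)
qed

lemma inj_matrix_inv:
  assumes "invertible A" shows "inj ((*v) (matrix_inv A))"
proof -
  have "A *v (matrix_inv A *v v) = v" for v
    by (simp add: matrix_vector_mul_assoc matrix_inv_mult(2) [OF assms])
  then show ?thesis
    by (metis injI)
qed

text \<open>The bound 1/2 in the smallness condition keeps \<open>\<omega>\<close> along the curve
  between one half and three halves of the elapsed parameter, which yields injectivity and the signs
  at the endpoints.\<close>

locale level_curve = hor_chart +
  fixes q :: heis and \<delta> :: real and \<gamma> :: "real \<Rightarrow> heis"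
  assumes \<delta>: "0 < \<delta>" "sew * (2 * \<delta>) powr \<alpha> \<le> 1 / 2"
    and start: "\<gamma> 0 = q"
    and curve: "\<gamma> t \<in> hball d p r" "f (\<gamma> t) = f q"
    and increment: "s \<in> {-\<delta>..\<delta>} \<Longrightarrow> t \<in> {-\<delta>..\<delta>} \<Longrightarrow>
      \<bar>\<omega> (\<gamma> s) (\<gamma> t) - (t - s)\<bar> \<le> sew * \<bar>t - s\<bar> powr (1 + \<alpha>)"
begin

section \<open>Injectivity, continuity and covering property of a level curve\<close>

lemma increment_half:
  assumes "s \<in> {-\<delta>..\<delta>}" "t \<in> {-\<delta>..\<delta>}"
  shows "2 * \<bar>\<omega> (\<gamma> s) (\<gamma> t) - (t - s)\<bar> \<le> \<bar>t - s\<bar>"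
proof -
  have "\<bar>t - s\<bar> \<le> 2 * \<delta>"
    using assms by (auto simp: abs_le_iff)
  then have "sew * \<bar>t - s\<bar> powr (1 + \<alpha>) \<le> 1 / 2 * \<bar>t - s\<bar>"
    using \<delta>(2) by (intro powr_one_plus_le) auto
  then show ?thesis
    using increment [OF assms] by simp
qed

lemma curve_gauge:
  assumes "s \<in> {-\<delta>..\<delta>}" "t \<in> {-\<delta>..\<delta>}"
  shows "gauge_h (hmul (hinv (\<gamma> s)) (\<gamma> t)) \<le> 2 * sqrt (2 * \<bar>t - s\<bar>)"
proof -
  have "\<bar>\<omega> (\<gamma> s) (\<gamma> t)\<bar> \<le> 2 * \<bar>t - s\<bar>"
    using increment_half [OF assms] by (smt (verit))
  then have "2 * sqrt \<bar>\<omega> (\<gamma> s) (\<gamma> t)\<bar> \<le> 2 * sqrt (2 * \<bar>t - s\<bar>)"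
    by (intro mult_left_mono real_sqrt_le_mono) auto
  moreover have "gauge_h (hmul (hinv (\<gamma> s)) (\<gamma> t)) \<le> 2 * sqrt \<bar>\<omega> (\<gamma> s) (\<gamma> t)\<bar>"
    using curve by (intro level_gauge) auto
  ultimately show ?thesis
    by (rule order_trans [rotated])
qed

lemma inj_on_curve: "inj_on \<gamma> {-\<delta>..\<delta>}"
proof (rule inj_onI)
  fix s t assume st: "s \<in> {-\<delta>..\<delta>}" "t \<in> {-\<delta>..\<delta>}" "\<gamma> s = \<gamma> t"
  then show "s = t"
    using increment_half [of s t] by (simp add: abs_minus_commute)
qed

lemma hcontinuous_on_curve: "hcontinuous_on d {-\<delta>..\<delta>} \<gamma>"
  unfolding hcontinuous_on_def
proof (intro ballI allI impI)
  obtain k where k: "k > 0" "\<And>x y. d x y \<le> k * gauge_h (hmul (hinv x) y)"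
    using d_le_gauge_h by blast
  fix t e :: real assume t: "t \<in> {-\<delta>..\<delta>}" and e: "e > 0"
  show "\<exists>\<eta>>0. \<forall>s\<in>{-\<delta>..\<delta>}. \<bar>s - t\<bar> < \<eta> \<longrightarrow> d (\<gamma> s) (\<gamma> t) < e"
  proof (intro exI conjI ballI impI)
    show "0 < (e / (2 * k))\<^sup>2 / 2" using e k by simp
    fix s assume s: "s \<in> {-\<delta>..\<delta>}" "\<bar>s - t\<bar> < (e / (2 * k))\<^sup>2 / 2"
    then have "sqrt (2 * \<bar>t - s\<bar>) < e / (2 * k)"
      using e k by (intro real_less_lsqrt) (auto simp: abs_minus_commute)
    then have "k * (2 * sqrt (2 * \<bar>t - s\<bar>)) < e"
      using k by (simp add: field_simps)
    moreover have "d (\<gamma> s) (\<gamma> t) \<le> k * (2 * sqrt (2 * \<bar>t - s\<bar>))"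
      using curve_gauge [OF s(1) t] k(1) by (intro order_trans [OF k(2)] mult_left_mono) auto
    ultimately show "d (\<gamma> s) (\<gamma> t) < e" by linarith
  qed
qed

text \<open>The vertical displacement from \<open>\<gamma>\<^sub>t\<close> to \<open>y\<close> changes sign along the curve, and two points
  of a level set without relative vertical displacement coincide.\<close>
lemma curve_covers:
  assumes k: "0 < k" "\<And>x y. gauge_h (hmul (hinv x) y) \<le> k * d x y"
    and y: "y \<in> hball d p r" "f y = f q"
    and small: "gauge_h (hmul (hinv q) y) \<le> 1"
      "(1 + 2 * k * r) * gauge_h (hmul (hinv q) y) \<le> \<delta> / 2"
  shows "y \<in> \<gamma> ` {-\<delta>..\<delta>}"
proof -
  let ?g = "gauge_h (hmul (hinv q) y)"
  define K where "K = 2 * k * r"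
  have K: "norm (hhor (hmul (hinv x) z)) \<le> K" if "x \<in> hball d p r" "z \<in> hball d p r" for x z
  proof -
    have "d x z \<le> 2 * r"
      using that d_triangle [of x z p] d_sym [of x p] by (simp add: hball_def)
    then have "gauge_h (hmul (hinv x) z) \<le> k * (2 * r)"
      using k by (intro order_trans [OF k(2)] mult_left_mono) auto
    then show ?thesis
      using norm_hhor_le_gauge_h [of "hmul (hinv x) z"] by (simp add: K_def)
  qed
  have q: "q \<in> hball d p r"
    using curve(1) [of 0] start by simp
  define \<phi> where "\<phi> t = \<omega> (\<gamma> t) y" for t
  \<comment> \<open>Splitting at \<open>q\<close>, both the height from \<open>q\<close> to
    \<open>y\<close> and the area term are small because \<open>y\<close> is close to
    \<open>q\<close>.\<close>
  have near: "\<bar>\<phi> t - \<omega> (\<gamma> t) q\<bar> \<le> \<delta> / 2" for t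
  proof -
    have "\<bar>\<phi> t - \<omega> (\<gamma> t) q\<bar> \<le> \<bar>\<omega> q y\<bar> + norm (hhor (hmul (hinv (\<gamma> t)) q)) * norm (hhor (hmul (hinv q) y))"
      using hver_chasles [of "\<gamma> t" y q]
        abs_wedge_le [of "hhor (hmul (hinv (\<gamma> t)) q)" "hhor (hmul (hinv q) y)"]
      unfolding \<phi>_def by linarith
    also have "\<bar>\<omega> q y\<bar> \<le> ?g"
    proof -
      have "\<bar>\<omega> q y\<bar> = (sqrt \<bar>\<omega> q y\<bar>)\<^sup>2" by simp
      also have "\<dots> \<le> ?g\<^sup>2" by (intro power_mono) (auto simp: gauge_h_def)
      also have "\<dots> \<le> ?g"
        using small(1) mult_left_mono [of ?g 1 ?g] by (simp add: power2_eq_square)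
      finally show ?thesis .
    qed
    also have "norm (hhor (hmul (hinv (\<gamma> t)) q)) * norm (hhor (hmul (hinv q) y)) \<le> K * ?g"
      using K [OF curve(1) [of t] q] k r
      by (intro mult_mono norm_hhor_le_gauge_h) (auto simp: K_def)
    finally show ?thesis
      using small(2) by (simp add: K_def algebra_simps)
  qed
  \<comment> \<open>At the endpoints the displacement to \<open>q\<close> is at least
    \<open>\<delta> / 2\<close> in size, with opposite signs; a perturbation of at most
    \<open>\<delta> / 2\<close> cannot reverse them.\<close>
  have "\<phi> \<delta> \<le> 0" "0 \<le> \<phi> (- \<delta>)"
    using near [of \<delta>] near [of "-\<delta>"] increment_half [of \<delta> 0] increment_half [of "-\<delta>" 0] \<delta>(1)
    by (simp_all add: start) (smt (verit))+
  moreover have "continuous_on {-\<delta>..\<delta>} \<phi>"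
    unfolding continuous_on_def
  proof
    fix t assume t: "t \<in> {-\<delta>..\<delta>}"
    define b where "b s = 2 * \<bar>t - s\<bar> + 2 * sqrt (2 * \<bar>t - s\<bar>) * K" for s
    have bound: "norm (\<phi> s - \<phi> t) \<le> b s" if s: "s \<in> {-\<delta>..\<delta>}" for s
    proof -
      have "norm (hhor (hmul (hinv (\<gamma> s)) (\<gamma> t))) * norm (hhor (hmul (hinv (\<gamma> t)) y))
          \<le> 2 * sqrt (2 * \<bar>t - s\<bar>) * K"
        using K [OF curve(1) y(1)] curve_gauge [OF s t]
          norm_hhor_le_gauge_h [of "hmul (hinv (\<gamma> s)) (\<gamma> t)"]
        by (intro mult_mono) auto
      moreover have "\<bar>\<omega> (\<gamma> s) (\<gamma> t)\<bar> \<le> 2 * \<bar>t - s\<bar>"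
        using increment_half [OF s t] by (smt (verit))
      ultimately show ?thesis
        using hver_chasles [of "\<gamma> s" y "\<gamma> t"]
          abs_wedge_le [of "hhor (hmul (hinv (\<gamma> s)) (\<gamma> t))" "hhor (hmul (hinv (\<gamma> t)) y)"]
        unfolding \<phi>_def b_def real_norm_def by linarith
    qed
    have "continuous_on UNIV b"
      unfolding b_def by (intro continuous_intros)
    then have "(b \<longlongrightarrow> b t) (at t within {-\<delta>..\<delta>})"
      using continuous_on_subset [of UNIV b "{-\<delta>..\<delta>}"] t unfolding continuous_on_def by blast
    then have "(b \<longlongrightarrow> 0) (at t within {-\<delta>..\<delta>})"
      by (simp add: b_def)
    then have "((\<lambda>s. \<phi> s - \<phi> t) \<longlongrightarrow> 0) (at t within {-\<delta>..\<delta>})"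
      by (rule Lim_null_comparison [rotated])
        (use bound in \<open>auto simp: eventually_at intro!: exI [of _ 1]\<close>)
    then show "(\<phi> \<longlongrightarrow> \<phi> t) (at t within {-\<delta>..\<delta>})"
      by (rule Lim_null [THEN iffD2])
  qed
  ultimately obtain t where t: "t \<in> {-\<delta>..\<delta>}" "\<phi> t = 0"
    using IVT2' [of \<phi> \<delta> 0 "- \<delta>"] \<delta>(1) by auto
  then have "\<gamma> t = y"
    using curve y by (intro level_eq) (auto simp: \<phi>_def)
  with t show ?thesis by blast
qed

end

theorem mainTheorem6:
  fixes d :: "heis \<Rightarrow> heis \<Rightarrow> real" and \<alpha> :: real
    and F :: "heis \<Rightarrow> real^2" and p :: heis
  assumes "homog_dist d"
    and "0 < \<alpha>" and "\<alpha> \<le> 1"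
    and "C1alpha_h d \<alpha> F"
    and "nondegenerate F p"
  shows "\<exists>\<delta>4>0. \<forall>\<delta>. 0 < \<delta> \<and> \<delta> \<le> \<delta>4 \<longrightarrow>
           (\<exists>\<epsilon>4>0. \<forall>q\<in>hball d p \<epsilon>4. \<exists>\<gamma>.
              LSDE d \<alpha> F p {-\<delta>..\<delta>} \<gamma> \<and> inj_on \<gamma> {-\<delta>..\<delta>} \<and> \<gamma> 0 = q \<and>
              \<gamma> ` {-\<delta>..\<delta>} \<inter> hball d p \<epsilon>4 = F -` {F q} \<inter> hball d p \<epsilon>4)"
proof -
  interpret homog d by unfold_locales (fact assms(1))
  have inv: "invertible (gradh F p)"
    using assms(5) by (simp add: nondegenerate_def)
  define f where "f = (\<lambda>x. matrix_inv (gradh F p) *v F x)"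
  \<comment> \<open>Normalization by an invertible matrix does not change level sets.\<close>
  have f_iff: "f x = f y \<longleftrightarrow> F x = F y" for x y
    unfolding f_def by (rule inj_eq [OF inj_matrix_inv [OF inv]])
  obtain r C where rC: "r > 0" "C \<ge> 0" and est: "\<And>x y. x \<in> hball d p r \<Longrightarrow> y \<in> hball d p r \<Longrightarrow>
     norm (f y - f x - hhor (hmul (hinv x) y)) \<le> gauge_h (hmul (hinv x) y) / 4 \<and>
     (f x = f y \<longrightarrow> norm (hhor (hmul (hinv x) y)) \<le> C * \<bar>hver (hmul (hinv x) y)\<bar> powr ((1 + \<alpha>) / 2))"
    using level_set_estimates [OF assms(4,2,5)] unfolding f_def by blast
  interpret hor_chart d f p r C \<alpha>
    by unfold_locales (use rC est assms(2,3) in auto)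
  obtain k where k: "k > 0" "\<And>x y. d x y \<le> k * gauge_h (hmul (hinv x) y)"
    using d_le_gauge_h by blast
  obtain k' where k': "k' > 0" "\<And>x y. gauge_h (hmul (hinv x) y) \<le> k' * d x y"
    using gauge_h_le_d by blast
  \<comment> \<open>The first bound makes the sewing error at most half the parameter, the second
    keeps the chain in the chart ball. The \<open>+ 1\<close> keeps \<open>\<delta>0\<close>
    positive when \<open>sew\<close> is 0.\<close>
  define \<delta>0 where "\<delta>0 = min ((1 / (2 * (sew + 1))) powr (1 / \<alpha>)) ((r / (8 * k))\<^sup>2) / 2"
  have \<delta>0: "0 < \<delta>0"
    using sew_nonneg k(1) r by (simp add: \<delta>0_def)
  have \<delta>0_sew: "sew * (2 * \<delta>) powr \<alpha> \<le> 1 / 2" if "0 < \<delta>" "\<delta> \<le> \<delta>0" for \<delta>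
  proof -
    have "(2 * \<delta>) powr \<alpha> \<le> ((1 / (2 * (sew + 1))) powr (1 / \<alpha>)) powr \<alpha>"
      using that \<alpha> by (intro powr_mono2) (auto simp: \<delta>0_def)
    also have "\<dots> = 1 / (2 * (sew + 1))"
      using \<alpha> sew_nonneg by (simp add: powr_powr)
    finally have "sew * (2 * \<delta>) powr \<alpha> \<le> sew * (1 / (2 * (sew + 1)))"
      using sew_nonneg by (rule mult_left_mono)
    also have "\<dots> \<le> 1 / 2"
      using sew_nonneg by (simp add: field_simps)
    finally show ?thesis .
  qed
  have \<delta>0_r: "8 * k * sqrt (2 * \<delta>) \<le> r" if "0 < \<delta>" "\<delta> \<le> \<delta>0" for \<delta>
  proof -
    have "sqrt (2 * \<delta>) \<le> sqrt ((r / (8 * k))\<^sup>2)"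
      using that by (intro real_sqrt_le_mono) (auto simp: \<delta>0_def)
    also have "\<dots> = r / (8 * k)"
      using r k(1) by simp
    finally show ?thesis
      using k(1) by (simp add: field_simps)
  qed
  show ?thesis
  proof (rule exI [of _ \<delta>0], intro conjI \<delta>0 allI impI)
    fix \<delta> assume "0 < \<delta> \<and> \<delta> \<le> \<delta>0"
    then have \<delta>: "0 < \<delta>" "sew * (2 * \<delta>) powr \<alpha> \<le> 1 / 2" "8 * k * sqrt (2 * \<delta>) \<le> r"
      using \<delta>0_sew \<delta>0_r by auto
    \<comment> \<open>\<open>m\<close> is the gauge threshold of \<open>curve_covers\<close>. Two
      points of the ball of radius \<open>\<epsilon>\<close> are less than
      \<open>2 * \<epsilon>\<close> apart, whence the choice of \<open>\<epsilon>\<close>; the bound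
      \<open>r / 4\<close> is for \<open>level_curve_exists\<close>.\<close>
    define m where "m = min 1 (\<delta> / (2 * (1 + 2 * k' * r)))"
    define \<epsilon> where "\<epsilon> = min (r / 4) (m / (2 * k'))"
    have kr: "1 + 2 * k' * r > 0"
      using k'(1) r by (simp add: add_pos_pos)
    have m: "0 < m" "m \<le> 1" "(1 + 2 * k' * r) * m \<le> \<delta> / 2"
    proof -
      have "(1 + 2 * k' * r) * m \<le> (1 + 2 * k' * r) * (\<delta> / (2 * (1 + 2 * k' * r)))"
        using kr by (intro mult_left_mono) (auto simp: m_def)
      also have "\<dots> = \<delta> / 2" using kr by (simp add: field_simps)
      finally show "(1 + 2 * k' * r) * m \<le> \<delta> / 2" .
    qed (use kr \<delta>(1) in \<open>auto simp: m_def\<close>)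
    have \<epsilon>: "0 < \<epsilon>" "\<epsilon> \<le> r / 4" "k' * (2 * \<epsilon>) \<le> m"
      using r k'(1) m(1) by (auto simp: \<epsilon>_def min_def field_simps)
    have "\<exists>\<gamma>. LSDE d \<alpha> F p {-\<delta>..\<delta>} \<gamma> \<and> inj_on \<gamma> {-\<delta>..\<delta>} \<and> \<gamma> 0 = q \<and>
              \<gamma> ` {-\<delta>..\<delta>} \<inter> hball d p \<epsilon> = F -` {F q} \<inter> hball d p \<epsilon>"
      if q: "q \<in> hball d p \<epsilon>" for q
    proof -
      have sub: "hball d p \<epsilon> \<subseteq> hball d p (r/4)" "hball d p \<epsilon> \<subseteq> hball d p r"
        using \<epsilon>(2) r by (auto simp: hball_def)
      have "sew * (2 * \<delta>) powr \<alpha> \<le> 1" using \<delta>(2) by simp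
      from level_curve_exists [OF k \<delta>(1) this \<delta>(3), of q] q sub obtain \<gamma> where \<gamma>: "\<gamma> 0 = q"
        "\<And>t. \<gamma> t \<in> hball d p r \<and> f (\<gamma> t) = f q"
        "\<And>s t. s \<in> {-\<delta>..\<delta>} \<Longrightarrow> t \<in> {-\<delta>..\<delta>} \<Longrightarrow>
           \<bar>\<omega> (\<gamma> s) (\<gamma> t) - (t - s)\<bar> \<le> sew * \<bar>t - s\<bar> powr (1 + \<alpha>)"
        by blast
      interpret level_curve d f p r C \<alpha> q \<delta> \<gamma>
        by unfold_locales (use \<gamma> \<delta> in auto)
      have F\<gamma>: "F (\<gamma> t) = F q" for t
        using curve(2) f_iff by blast
      have "LSDE d \<alpha> F p {-\<delta>..\<delta>} \<gamma>"
        unfolding LSDE_def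
      proof (intro conjI ballI)
        show "is_interval {-\<delta>..\<delta>}" by (rule is_interval_cc)
        show "hcontinuous_on d {-\<delta>..\<delta>} \<gamma>" by (rule hcontinuous_on_curve)
        show "hhor (hmul (hinv (\<gamma> s)) (\<gamma> t)) =
            - (matrix_inv (gradh F p) *v (Rem F p (\<gamma> t) - Rem F p (\<gamma> s)))" for s t
          by (intro hhor_eq_Rem inv) (simp add: F\<gamma>)
        show "\<exists>E. (\<forall>s\<in>{-\<delta>..\<delta>}. \<forall>t\<in>{-\<delta>..\<delta>}. \<omega> (\<gamma> s) (\<gamma> t) = t - s + E s t) \<and>
            (\<exists>C. \<forall>s\<in>{-\<delta>..\<delta>}. \<forall>t\<in>{-\<delta>..\<delta>}. s \<noteq> t \<longrightarrow> \<bar>E s t\<bar> \<le> C * \<bar>t - s\<bar> powr (1 + \<alpha>))"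
          using increment by (intro exI [of _ "\<lambda>s t. \<omega> (\<gamma> s) (\<gamma> t) - (t - s)"] conjI exI [of _ sew]) auto
      qed
      moreover have "y \<in> \<gamma> ` {-\<delta>..\<delta>}" if y: "y \<in> hball d p \<epsilon>" "F y = F q" for y
      proof -
        have "d q y \<le> 2 * \<epsilon>"
          using d_triangle [of q y p] d_sym [of q p] q y(1) by (simp add: hball_def)
        then have "gauge_h (hmul (hinv q) y) \<le> k' * (2 * \<epsilon>)"
          using k'(1) by (intro order_trans [OF k'(2)] mult_left_mono) auto
        then have g: "gauge_h (hmul (hinv q) y) \<le> m"
          using \<epsilon>(3) by linarith
        have "(1 + 2 * k' * r) * gauge_h (hmul (hinv q) y) \<le> (1 + 2 * k' * r) * m"
          using g kr by (intro mult_left_mono) auto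
        then show ?thesis
          using k' y sub f_iff g m by (intro curve_covers [of k']) auto
      qed
      then have "\<gamma> ` {-\<delta>..\<delta>} \<inter> hball d p \<epsilon> = F -` {F q} \<inter> hball d p \<epsilon>"
        using F\<gamma> by auto
      ultimately show ?thesis
        using inj_on_curve start by blast
    qed
    then show "\<exists>\<epsilon>4>0. \<forall>q\<in>hball d p \<epsilon>4. \<exists>\<gamma>.
              LSDE d \<alpha> F p {-\<delta>..\<delta>} \<gamma> \<and> inj_on \<gamma> {-\<delta>..\<delta>} \<and> \<gamma> 0 = q \<and>
              \<gamma> ` {-\<delta>..\<delta>} \<inter> hball d p \<epsilon>4 = F -` {F q} \<inter> hball d p \<epsilon>4"
      using \<epsilon>(1) by blast
  qed
qed

end
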